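(* Let $M$ be a biwarped product proper generalized $J$-induced submanifold of order 1 of the form $M_T\times_f M_\bot\times_\sigma M_\theta$ of a Kähler manifold $(\bar M,J,g)$ such that the invariant normal subbundle satisfies $\overline{\mathcal{D}}^T=\{0\}$. Then $M$ is locally trivial if and only if $M$ is both $(\mathcal{D}^T,\mathcal{D}^\bot)$-mixed geodesic and $(\mathcal{D}^T,\mathcal{D}^\theta)$-mixed geodesic.
   Context: A Kähler manifold $(\bar M,J,g)$ is an almost complex manifold with Riemannian metric $g$ with $g(JX,JY)=g(X,Y)$ and $\bar\nabla J=0$, where $\bar\nabla$ is the Levi-Civita connection. For an isometrically immersed submanifold $M$ of $\bar M$, $h$ is the second fundamental form ($\bar\nabla_UV=\nabla_UV+h(U,V)$). For $V\in TM$ write $JV=TV+FV$ with $TV$ tangential and $FV$ normal to $M$. A distribution $\mathcal{D}$ on $M$ is holomorphic if $J\mathcal{D}_p\subseteq\mathcal{D}_p$ for all $p$, totally real if $J\mathcal{D}_p\subseteq T_p^\bot M$ for all $p$, and pointwise slant with slant function $\theta$ if at each $p$ the angle $\theta(p)$ between $JV$ and $\mathcal{D}_p$ is the same for all nonzero $V\in\mathcal{D}_p$. A submanifold is holomorphic, totally real, or pointwise slant if its tangent bundle has the corresponding property. A generalized $J$-induced submanifold of order 1 is a submanifold $M$ of $\bar M$ with orthogonal decomposition $TM=\mathcal{D}^T\oplus\mathcal{D}^\bot\oplus\mathcal{D}^\theta$, where $\mathcal{D}^T$ is holomorphic, $\mathcal{D}^\bot$ totally real and $\mathcal{D}^\theta$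 pointwise slant with slant function $\theta$. It is proper if $\mathcal{D}^T\neq\{0\}$, $\mathcal{D}^\bot\neq\{0\}$ and $\theta$ takes values in $(0,\frac{\pi}{2})$. The normal bundle decomposes as $T^\bot M=J(\mathcal{D}^\bot)\oplus F(\mathcal{D}^\theta)\oplus\overline{\mathcal{D}}^T$, where $\overline{\mathcal{D}}^T$ is the orthogonal complement of $J(\mathcal{D}^\bot)\oplus F(\mathcal{D}^\theta)$ in $T^\bot M$; it is $J$-invariant. For Riemannian manifolds $(M_i,g_i)$, $i=0,1,2$, and smooth $f_1,f_2:M_0\to(0,\infty)$, the biwarped product $M_0\times_{f_1}M_1\times_{f_2}M_2$ is $M_0\times M_1\times M_2$ with metric $\pi_0^*g_0+(f_1\circ\pi_0)^2\pi_1^*g_1+(f_2\circ\pi_0)^2\pi_2^*g_2$. It is trivial if the warping functions $f_1$ and $f_2$ are constants; it is locally trivial if this holds locally. In $M=M_T\times_fM_\bot\times_\sigma M_\theta$ the factors $M_T$ (holomorphic), $M_\bot$ (totally real), $M_\theta$ (pointwise slant) are tangent to $\mathcal{D}^T,\mathcal{D}^\bot,\mathcal{D}^\theta$ respectively, and $f,\sigma:M_T\to(0,\infty)$ are smooth. $M$ is $(\mathcal{D}^1,\mathcal{D}^2)$-mixed geodesic if $h(V,X)=0$ for all $V\in\mathcal{D}^1$ and $X\in\mathcal{D}^2$. *)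

theory Defs
  imports "HOL-Analysis.Analysis"
begin

section \<open>Smooth manifolds\<close>

text \<open>\<open>Ck_on k h S\<close>: on the open set \<open>S\<close>, \<open>h\<close> has continuous iterated directional derivatives of all
  orders up to \<open>k\<close>, those of order below \<open>k\<close> being Frechet differentiable.\<close>

primrec Ck_on :: "nat \<Rightarrow> ('a::real_normed_vector \<Rightarrow> 'b::real_normed_vector) \<Rightarrow> 'a set \<Rightarrow> bool" where
  "Ck_on 0 = (\<lambda>h S. continuous_on S h)"
| "Ck_on (Suc k) = (\<lambda>h S. (\<forall>x\<in>S. h differentiable (at x)) \<and>
     (\<forall>v. Ck_on k (\<lambda>x. frechet_derivative h (at x) v) S))"

definition smooth_on :: "('a::real_normed_vector \<Rightarrow> 'b::real_normed_vector) \<Rightarrow> 'a set \<Rightarrow> bool" where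
  "smooth_on h S \<longleftrightarrow> (\<forall>k. Ck_on k h S)"

text \<open>A chart is its domain together with the coordinate map. The points of a manifold are the elements
  of a topological type \<open>'m\<close>; the model space \<open>'a\<close> is a Euclidean space, so the dimension
  is \<open>DIM('a)\<close>, which is always positive.\<close>

type_synonym ('m, 'a) chart = "'m set \<times> ('m \<Rightarrow> 'a)"

abbreviation cdom :: "('m, 'a) chart \<Rightarrow> 'm set" where "cdom \<equiv> fst"
abbreviation cmap :: "('m, 'a) chart \<Rightarrow> 'm \<Rightarrow> 'a" where "cmap \<equiv> snd"
abbreviation cran :: "('m, 'a) chart \<Rightarrow> 'a set" where "cran c \<equiv> cmap c ` cdom c"
abbreviation cinv :: "('m, 'a) chart \<Rightarrow> 'a \<Rightarrow> 'm" where "cinv c \<equiv> inv_into (cdom c) (cmap c)"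

definition transition :: "('m, 'a) chart \<Rightarrow> ('m, 'b) chart \<Rightarrow> 'a \<Rightarrow> 'b" where
  "transition c d x = cmap d (cinv c x)"

definition smooth_atlas ::
  "('m::{t2_space, second_countable_topology}, 'a::euclidean_space) chart set \<Rightarrow> bool" where
  "smooth_atlas A \<longleftrightarrow>
     (\<Union>c\<in>A. cdom c) = UNIV \<and>
     (\<forall>c\<in>A. open (cdom c) \<and> open (cran c) \<and> homeomorphism (cdom c) (cran c) (cmap c) (cinv c)) \<and>
     (\<forall>c\<in>A. \<forall>d\<in>A. smooth_on (transition c d) (cmap c ` (cdom c \<inter> cdom d)))"

text \<open>Tangent vectors: for each point \<open>p\<close> one chart \<open>chart_at A p\<close> around \<open>p\<close> is chosen, and
  \<open>T\<^sub>pM\<close> is identified with the model space by taking components in that chart. The maps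
  \<open>tcoord\<close> and \<open>tvec\<close> pass to and from the components in any other chart \<open>c\<close> around \<open>p\<close>.
  Vector fields are functions \<open>'m \<Rightarrow> 'a\<close>, read at each \<open>p\<close> in the chosen chart there.\<close>

definition chart_at :: "('m, 'a) chart set \<Rightarrow> 'm \<Rightarrow> ('m, 'a) chart" where
  "chart_at A p = (SOME c. c \<in> A \<and> p \<in> cdom c)"

definition tcoord ::
  "('m, 'a::euclidean_space) chart set \<Rightarrow> ('m, 'a) chart \<Rightarrow> 'm \<Rightarrow> 'a \<Rightarrow> 'a" where
  "tcoord A c p u =
     frechet_derivative (transition (chart_at A p) c) (at (cmap (chart_at A p) p)) u"

definition tvec ::
  "('m, 'a::euclidean_space) chart set \<Rightarrow> ('m, 'a) chart \<Rightarrow> 'm \<Rightarrow> 'a \<Rightarrow> 'a" where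
  "tvec A c p w = frechet_derivative (transition c (chart_at A p)) (at (cmap c p)) w"

definition differential ::
  "('m, 'a::euclidean_space) chart set \<Rightarrow> ('n, 'b::euclidean_space) chart set
     \<Rightarrow> ('m \<Rightarrow> 'n) \<Rightarrow> 'm \<Rightarrow> 'a \<Rightarrow> 'b" where
  "differential A B F p u =
     frechet_derivative (\<lambda>x. cmap (chart_at B (F p)) (F (cinv (chart_at A p) x)))
       (at (cmap (chart_at A p) p)) u"

definition smooth_function :: "('m, 'a::euclidean_space) chart set \<Rightarrow> ('m \<Rightarrow> real) \<Rightarrow> bool" where
  "smooth_function A h \<longleftrightarrow> (\<forall>c\<in>A. smooth_on (\<lambda>x. h (cinv c x)) (cran c))"

definition smooth_map ::
  "('m::topological_space, 'a::euclidean_space) chart set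
     \<Rightarrow> ('n::topological_space, 'b::euclidean_space) chart set \<Rightarrow> ('m \<Rightarrow> 'n) \<Rightarrow> bool" where
  "smooth_map A B F \<longleftrightarrow> continuous_on UNIV F \<and>
     (\<forall>c\<in>A. \<forall>d\<in>B. smooth_on (\<lambda>x. cmap d (F (cinv c x))) (cmap c ` (cdom c \<inter> F -` cdom d)))"

definition smooth_field_on ::
  "('m::topological_space, 'a::euclidean_space) chart set \<Rightarrow> 'm set \<Rightarrow> ('m \<Rightarrow> 'a) \<Rightarrow> bool" where
  "smooth_field_on A W V \<longleftrightarrow> open W \<and>
     (\<forall>c\<in>A. smooth_on (\<lambda>x. tcoord A c (cinv c x) (V (cinv c x))) (cmap c ` (cdom c \<inter> W)))"

definition distribution ::
  "('m::topological_space, 'a::euclidean_space) chart set \<Rightarrow> ('m \<Rightarrow> 'a set) \<Rightarrow> bool" where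
  "distribution A D \<longleftrightarrow>
     (\<forall>p. subspace (D p)) \<and> (\<exists>k. \<forall>p. dim (D p) = k) \<and>
     (\<forall>p. \<forall>u\<in>D p. \<exists>W V. p \<in> W \<and> smooth_field_on A W V \<and> (\<forall>q\<in>W. V q \<in> D q) \<and> V p = u)"


section \<open>Riemannian manifolds and the Levi-Civita connection\<close>

record ('m, 'a) riem =
  atlas :: "('m, 'a) chart set"
  metric :: "'m \<Rightarrow> 'a \<Rightarrow> 'a \<Rightarrow> real"

definition inner_form :: "('a::real_vector \<Rightarrow> 'a \<Rightarrow> real) \<Rightarrow> bool" where
  "inner_form b \<longleftrightarrow> bilinear b \<and> (\<forall>u v. b u v = b v u) \<and> (\<forall>u. u \<noteq> 0 \<longrightarrow> b u u > 0)"

definition metric_in ::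
  "('m, 'a::euclidean_space) riem \<Rightarrow> ('m, 'a) chart \<Rightarrow> 'a \<Rightarrow> 'a \<Rightarrow> 'a \<Rightarrow> real" where
  "metric_in M c x u v =
     metric M (cinv c x) (tvec (atlas M) c (cinv c x) u) (tvec (atlas M) c (cinv c x) v)"

definition riemannian_manifold ::
  "('m::{t2_space, second_countable_topology}, 'a::euclidean_space) riem \<Rightarrow> bool" where
  "riemannian_manifold M \<longleftrightarrow> smooth_atlas (atlas M) \<and> (\<forall>p. inner_form (metric M p)) \<and>
     (\<forall>c\<in>atlas M. \<forall>u v. smooth_on (\<lambda>x. metric_in M c x u v) (cran c))"

text \<open>In a chart, a connection has the form \<open>\<nabla>\<^sub>u V = DV(u) + G(u, V)\<close>. It is torsion-free iff
  \<open>G\<close> is symmetric, and metric iff the last clause below holds; hence the unique such \<open>G\<close>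
  is that of the Levi-Civita connection.\<close>

definition christoffel_form ::
  "('m, 'a::euclidean_space) riem \<Rightarrow> ('m, 'a) chart \<Rightarrow> 'a \<Rightarrow> ('a \<Rightarrow> 'a \<Rightarrow> 'a) \<Rightarrow> bool" where
  "christoffel_form M c x G \<longleftrightarrow> bilinear G \<and> (\<forall>u v. G u v = G v u) \<and>
     (\<forall>u v w. frechet_derivative (\<lambda>y. metric_in M c y v w) (at x) u
        = metric_in M c x (G u v) w + metric_in M c x v (G u w))"

definition christoffel ::
  "('m, 'a::euclidean_space) riem \<Rightarrow> ('m, 'a) chart \<Rightarrow> 'a \<Rightarrow> 'a \<Rightarrow> 'a \<Rightarrow> 'a" where
  "christoffel M c x = (THE G. christoffel_form M c x G)"

text \<open>\<open>cov_deriv_along M N F p u Y\<close> is \<open>\<nabla>\<^sub>u Y\<close> at \<open>p\<close>, for \<open>\<nabla>\<close> the Levi-Civita connection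
  of \<open>N\<close> pulled back along \<open>F\<close>, \<open>u \<in> T\<^sub>pM\<close> and \<open>Y\<close> a section along \<open>F\<close>,
  i.e. \<open>Y q\<close> is tangent to \<open>N\<close> at \<open>F q\<close>.\<close>

definition cov_deriv_along ::
  "('m, 'a::euclidean_space) riem \<Rightarrow> ('n, 'b::euclidean_space) riem \<Rightarrow> ('m \<Rightarrow> 'n)
     \<Rightarrow> 'm \<Rightarrow> 'a \<Rightarrow> ('m \<Rightarrow> 'b) \<Rightarrow> 'b" where
  "cov_deriv_along M N F p u Y =
     (let c = chart_at (atlas M) p; d = chart_at (atlas N) (F p) in
      frechet_derivative (\<lambda>x. tcoord (atlas N) d (F (cinv c x)) (Y (cinv c x))) (at (cmap c p)) u
      + christoffel N d (cmap d (F p)) (differential (atlas M) (atlas N) F p u) (Y p))"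

definition levi_civita ::
  "('m, 'a::euclidean_space) riem \<Rightarrow> 'm \<Rightarrow> 'a \<Rightarrow> ('m \<Rightarrow> 'a) \<Rightarrow> 'a" where
  "levi_civita M p u V = cov_deriv_along M M (\<lambda>q. q) p u V"

definition kaehler_manifold ::
  "('m::{t2_space, second_countable_topology}, 'a::euclidean_space) riem
     \<Rightarrow> ('m \<Rightarrow> 'a \<Rightarrow> 'a) \<Rightarrow> bool" where
  "kaehler_manifold N J \<longleftrightarrow> riemannian_manifold N \<and>
     (\<forall>p. linear (J p) \<and> (\<forall>u. J p (J p u) = - u)) \<and>
     (\<forall>c\<in>atlas N. \<forall>u. smooth_on
        (\<lambda>x. tcoord (atlas N) c (cinv c x) (J (cinv c x) (tvec (atlas N) c (cinv c x) u))) (cran c)) \<and>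
     (\<forall>p u v. metric N p (J p u) (J p v) = metric N p u v) \<and>
     (\<forall>W V p u. smooth_field_on (atlas N) W V \<longrightarrow> p \<in> W \<longrightarrow>
        levi_civita N p u (\<lambda>q. J q (V q)) = J p (levi_civita N p u V))"


section \<open>Submanifolds\<close>

definition isometric_immersion ::
  "('m::topological_space, 'a::euclidean_space) riem
     \<Rightarrow> ('n::topological_space, 'b::euclidean_space) riem \<Rightarrow> ('m \<Rightarrow> 'n) \<Rightarrow> bool" where
  "isometric_immersion M N F \<longleftrightarrow> smooth_map (atlas M) (atlas N) F \<and>
     (\<forall>p. inj (differential (atlas M) (atlas N) F p)) \<and>
     (\<forall>p u v. metric M p u v =
        metric N (F p) (differential (atlas M) (atlas N) F p u) (differential (atlas M) (atlas N) F p v))"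

text \<open>A submanifold of \<open>N\<close> is given by \<open>M\<close> and an isometric immersion \<open>F\<close>; vectors tangent to it
  at \<open>F p\<close> are those of the form \<open>push M N F p u\<close>.\<close>

abbreviation push ::
  "('m, 'a::euclidean_space) riem \<Rightarrow> ('n, 'b::euclidean_space) riem \<Rightarrow> ('m \<Rightarrow> 'n)
     \<Rightarrow> 'm \<Rightarrow> 'a \<Rightarrow> 'b" where
  "push M N F \<equiv> differential (atlas M) (atlas N) F"

definition normal_space ::
  "('m, 'a::euclidean_space) riem \<Rightarrow> ('n, 'b::euclidean_space) riem \<Rightarrow> ('m \<Rightarrow> 'n) \<Rightarrow> 'm \<Rightarrow> 'b set"
  where
  "normal_space M N F p = {w. \<forall>u. metric N (F p) w (push M N F p u) = 0}"

definition orth_proj :: "('a::real_vector \<Rightarrow> 'a \<Rightarrow> real) \<Rightarrow> 'a set \<Rightarrow> 'a \<Rightarrow> 'a" where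
  "orth_proj b E w = (THE e. e \<in> E \<and> (\<forall>z\<in>E. b (w - e) z = 0))"

definition angle_to_subspace :: "('a::real_vector \<Rightarrow> 'a \<Rightarrow> real) \<Rightarrow> 'a set \<Rightarrow> 'a \<Rightarrow> real" where
  "angle_to_subspace b E w =
     arccos (sqrt (b (orth_proj b E w) (orth_proj b E w)) / sqrt (b w w))"

text \<open>The normal part \<open>F V\<close> of \<open>J V = T V + F V\<close>; the immersion is called \<open>i\<close> here.\<close>

definition normal_part_J ::
  "('m, 'a::euclidean_space) riem \<Rightarrow> ('n, 'b::euclidean_space) riem \<Rightarrow> ('n \<Rightarrow> 'b \<Rightarrow> 'b)
     \<Rightarrow> ('m \<Rightarrow> 'n) \<Rightarrow> 'm \<Rightarrow> 'a \<Rightarrow> 'b" where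
  "normal_part_J M N J i p v = J (i p) (push M N i p v)
     - orth_proj (metric N (i p)) (range (push M N i p)) (J (i p) (push M N i p v))"

text \<open>The value \<open>h(u, v)\<close> at \<open>p\<close> by the Gauss formula, with \<open>V\<close> any vector field of \<open>M\<close> near \<open>p\<close>
  extending \<open>v\<close>.\<close>

definition second_fundamental_form ::
  "('m::topological_space, 'a::euclidean_space) riem \<Rightarrow> ('n, 'b::euclidean_space) riem
     \<Rightarrow> ('m \<Rightarrow> 'n) \<Rightarrow> 'm \<Rightarrow> 'a \<Rightarrow> 'a \<Rightarrow> 'b" where
  "second_fundamental_form M N F p u v = (THE h. \<forall>W V.
     smooth_field_on (atlas M) W V \<longrightarrow> p \<in> W \<longrightarrow> V p = v \<longrightarrow>
       cov_deriv_along M N F p u (\<lambda>q. push M N F q (V q))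
         = push M N F p (levi_civita M p u V) + h)"

definition holomorphic_distribution ::
  "('m, 'a::euclidean_space) riem \<Rightarrow> ('n, 'b::euclidean_space) riem \<Rightarrow> ('n \<Rightarrow> 'b \<Rightarrow> 'b)
     \<Rightarrow> ('m \<Rightarrow> 'n) \<Rightarrow> ('m \<Rightarrow> 'a set) \<Rightarrow> bool" where
  "holomorphic_distribution M N J F D \<longleftrightarrow>
     (\<forall>p. J (F p) ` push M N F p ` D p \<subseteq> push M N F p ` D p)"

definition totally_real_distribution ::
  "('m, 'a::euclidean_space) riem \<Rightarrow> ('n, 'b::euclidean_space) riem \<Rightarrow> ('n \<Rightarrow> 'b \<Rightarrow> 'b)
     \<Rightarrow> ('m \<Rightarrow> 'n) \<Rightarrow> ('m \<Rightarrow> 'a set) \<Rightarrow> bool" where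
  "totally_real_distribution M N J F D \<longleftrightarrow>
     (\<forall>p. J (F p) ` push M N F p ` D p \<subseteq> normal_space M N F p)"

definition pointwise_slant_distribution ::
  "('m, 'a::euclidean_space) riem \<Rightarrow> ('n, 'b::euclidean_space) riem \<Rightarrow> ('n \<Rightarrow> 'b \<Rightarrow> 'b)
     \<Rightarrow> ('m \<Rightarrow> 'n) \<Rightarrow> ('m \<Rightarrow> 'a set) \<Rightarrow> ('m \<Rightarrow> real) \<Rightarrow> bool" where
  "pointwise_slant_distribution M N J F D \<theta> \<longleftrightarrow>
     (\<forall>p. \<forall>v\<in>D p. v \<noteq> 0 \<longrightarrow>
        angle_to_subspace (metric N (F p)) (push M N F p ` D p) (J (F p) (push M N F p v)) = \<theta> p)"

definition gen_J_induced_order1 ::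
  "('m::topological_space, 'a::euclidean_space) riem
     \<Rightarrow> ('n::topological_space, 'b::euclidean_space) riem \<Rightarrow> ('n \<Rightarrow> 'b \<Rightarrow> 'b) \<Rightarrow> ('m \<Rightarrow> 'n)
     \<Rightarrow> ('m \<Rightarrow> 'a set) \<Rightarrow> ('m \<Rightarrow> 'a set) \<Rightarrow> ('m \<Rightarrow> 'a set) \<Rightarrow> ('m \<Rightarrow> real) \<Rightarrow> bool" where
  "gen_J_induced_order1 M N J F DT DR DS \<theta> \<longleftrightarrow>
     isometric_immersion M N F \<and>
     distribution (atlas M) DT \<and> distribution (atlas M) DR \<and> distribution (atlas M) DS \<and>
     (\<forall>p. \<forall>u\<in>DT p. \<forall>v\<in>DR p. metric M p u v = 0) \<and>
     (\<forall>p. \<forall>u\<in>DT p. \<forall>v\<in>DS p. metric M p u v = 0) \<and>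
     (\<forall>p. \<forall>u\<in>DR p. \<forall>v\<in>DS p. metric M p u v = 0) \<and>
     (\<forall>p u. \<exists>x\<in>DT p. \<exists>y\<in>DR p. \<exists>z\<in>DS p. u = x + y + z) \<and>
     holomorphic_distribution M N J F DT \<and>
     totally_real_distribution M N J F DR \<and>
     pointwise_slant_distribution M N J F DS \<theta>"

definition proper_gen_J_induced_order1 ::
  "('m::topological_space, 'a::euclidean_space) riem
     \<Rightarrow> ('n::topological_space, 'b::euclidean_space) riem \<Rightarrow> ('n \<Rightarrow> 'b \<Rightarrow> 'b) \<Rightarrow> ('m \<Rightarrow> 'n)
     \<Rightarrow> ('m \<Rightarrow> 'a set) \<Rightarrow> ('m \<Rightarrow> 'a set) \<Rightarrow> ('m \<Rightarrow> 'a set) \<Rightarrow> ('m \<Rightarrow> real) \<Rightarrow> bool" where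
  "proper_gen_J_induced_order1 M N J F DT DR DS \<theta> \<longleftrightarrow>
     gen_J_induced_order1 M N J F DT DR DS \<theta> \<and>
     (\<forall>p. DT p \<noteq> {0}) \<and> (\<forall>p. DR p \<noteq> {0}) \<and> (\<forall>p. 0 < \<theta> p \<and> \<theta> p < pi / 2)"

text \<open>The orthogonal complement of \<open>J(DR) \<oplus> F(DS)\<close> in the normal bundle.\<close>

definition invariant_normal_subbundle ::
  "('m, 'a::euclidean_space) riem \<Rightarrow> ('n, 'b::euclidean_space) riem \<Rightarrow> ('n \<Rightarrow> 'b \<Rightarrow> 'b)
     \<Rightarrow> ('m \<Rightarrow> 'n) \<Rightarrow> ('m \<Rightarrow> 'a set) \<Rightarrow> ('m \<Rightarrow> 'a set) \<Rightarrow> 'm \<Rightarrow> 'b set" where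
  "invariant_normal_subbundle M N J F DR DS p =
     {w \<in> normal_space M N F p.
        (\<forall>v\<in>DR p. metric N (F p) w (J (F p) (push M N F p v)) = 0) \<and>
        (\<forall>v\<in>DS p. metric N (F p) w (normal_part_J M N J F p v) = 0)}"

definition mixed_geodesic ::
  "('m::topological_space, 'a::euclidean_space) riem \<Rightarrow> ('n, 'b::euclidean_space) riem
     \<Rightarrow> ('m \<Rightarrow> 'n) \<Rightarrow> ('m \<Rightarrow> 'a set) \<Rightarrow> ('m \<Rightarrow> 'a set) \<Rightarrow> bool" where
  "mixed_geodesic M N F D1 D2 \<longleftrightarrow>
     (\<forall>p. \<forall>v\<in>D1 p. \<forall>x\<in>D2 p. second_fundamental_form M N F p v x = 0)"


section \<open>Biwarped products\<close>

abbreviation proj0 :: "'p \<times> 'q \<times> 'r \<Rightarrow> 'p" where "proj0 \<equiv> fst"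
abbreviation proj1 :: "'p \<times> 'q \<times> 'r \<Rightarrow> 'q" where "proj1 \<equiv> \<lambda>z. fst (snd z)"
abbreviation proj2 :: "'p \<times> 'q \<times> 'r \<Rightarrow> 'r" where "proj2 \<equiv> \<lambda>z. snd (snd z)"

definition product_atlas ::
  "('p, 'a) chart set \<Rightarrow> ('q, 'b) chart set \<Rightarrow> ('r, 'c) chart set
     \<Rightarrow> ('p \<times> 'q \<times> 'r, 'a \<times> 'b \<times> 'c) chart set" where
  "product_atlas A0 A1 A2 =
     {(cdom c0 \<times> cdom c1 \<times> cdom c2, \<lambda>z. (cmap c0 (proj0 z), cmap c1 (proj1 z), cmap c2 (proj2 z)))
      | c0 c1 c2. c0 \<in> A0 \<and> c1 \<in> A1 \<and> c2 \<in> A2}"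

definition biwarped_product ::
  "('p, 'a::euclidean_space) riem \<Rightarrow> ('p \<Rightarrow> real) \<Rightarrow> ('q, 'b::euclidean_space) riem
     \<Rightarrow> ('p \<Rightarrow> real) \<Rightarrow> ('r, 'c::euclidean_space) riem
     \<Rightarrow> ('p \<times> 'q \<times> 'r, 'a \<times> 'b \<times> 'c) riem" where
  "biwarped_product M0 f1 M1 f2 M2 =
     (let A = product_atlas (atlas M0) (atlas M1) (atlas M2);
          d0 = differential A (atlas M0) proj0;
          d1 = differential A (atlas M1) proj1;
          d2 = differential A (atlas M2) proj2
      in \<lparr>atlas = A,
          metric = (\<lambda>z u v. metric M0 (proj0 z) (d0 z u) (d0 z v)
            + (f1 (proj0 z))\<^sup>2 * metric M1 (proj1 z) (d1 z u) (d1 z v)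
            + (f2 (proj0 z))\<^sup>2 * metric M2 (proj2 z) (d2 z u) (d2 z v))\<rparr>)"

text \<open>The vectors of the product \<open>M\<close> tangent to one factor are those killed by the differentials of the
  projections onto the other two.\<close>

definition tangent_factor0 ::
  "('p \<times> 'q \<times> 'r, 'd::euclidean_space) riem \<Rightarrow> ('q, 'b::euclidean_space) riem
     \<Rightarrow> ('r, 'c::euclidean_space) riem \<Rightarrow> 'p \<times> 'q \<times> 'r \<Rightarrow> 'd set" where
  "tangent_factor0 M M1 M2 z = {u. push M M1 proj1 z u = 0 \<and> push M M2 proj2 z u = 0}"

definition tangent_factor1 ::
  "('p \<times> 'q \<times> 'r, 'd::euclidean_space) riem \<Rightarrow> ('p, 'a::euclidean_space) riem
     \<Rightarrow> ('r, 'c::euclidean_space) riem \<Rightarrow> 'p \<times> 'q \<times> 'r \<Rightarrow> 'd set" where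
  "tangent_factor1 M M0 M2 z = {u. push M M0 proj0 z u = 0 \<and> push M M2 proj2 z u = 0}"

definition tangent_factor2 ::
  "('p \<times> 'q \<times> 'r, 'd::euclidean_space) riem \<Rightarrow> ('p, 'a::euclidean_space) riem
     \<Rightarrow> ('q, 'b::euclidean_space) riem \<Rightarrow> 'p \<times> 'q \<times> 'r \<Rightarrow> 'd set" where
  "tangent_factor2 M M0 M1 z = {u. push M M0 proj0 z u = 0 \<and> push M M1 proj1 z u = 0}"

text \<open>Triviality means that both warping functions are constant. As they live on the first factor,
  restricting the product to a neighbourhood of a point amounts to restricting them to an open \<open>U\<close>.\<close>

definition locally_trivial ::
  "('p::topological_space \<Rightarrow> real) \<Rightarrow> ('p \<Rightarrow> real) \<Rightarrow> bool" where
  "locally_trivial f1 f2 \<longleftrightarrow>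
     (\<forall>p. \<exists>U. open U \<and> p \<in> U \<and> f1 constant_on U \<and> f2 constant_on U)"

end

theory Submission
  imports Defs
begin

text \<open>In a product chart let \<open>X\<close> be a constant field of \<open>D\<^sup>T\<close>, let \<open>U, W\<close> be constant fields of
  \<open>D\<^sup>\<bottom> \<oplus> D\<^sup>\<theta>\<close>, and at the point \<open>p\<close> write \<open>JX = Y\<close>. As \<open>D\<^sup>T\<close> is holomorphic,
  \<open>g(JX, W)\<close> vanishes identically; differentiating it along \<open>U\<close> with the ambient connection and using
  \<open>\<nabla>J = 0\<close> gives \<open>g(\<nabla>\<^sub>U X, JW) = g(Y, \<nabla>\<^sub>U W)\<close>, where the left derivative is that of the
  ambient space. By Koszul's formula the right-hand side is \<open>- (1/2) Y g(U, W)\<close>, that is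
  \<open>- f Y(f) g\<^sub>1(U\<^sub>1, W\<^sub>1) - \<sigma> Y(\<sigma>) g\<^sub>2(U\<^sub>2, W\<^sub>2)\<close>, and the tangential part of
  \<open>\<nabla>\<^sub>U X\<close> is \<open>X(ln f) U\<^sub>1 + X(ln \<sigma>) U\<^sub>2\<close>. If \<open>h(X, U) = 0\<close> for \<open>U\<close> in one of the two
  distributions, then \<open>W = U\<close> makes the left-hand side vanish because \<open>JU\<close> is orthogonal to \<open>U\<close>, so
  \<open>Y(f) = Y(\<sigma>) = 0\<close>, and \<open>Y = JX\<close> is arbitrary. Conversely, if the warping functions are locally
  constant, then \<open>h(X, U)\<close> is normal and orthogonal to all \<open>JW\<close>, hence lies in the invariant
  normal subbundle.\<close>

section \<open>Smooth functions on open sets\<close>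

text \<open>Derivatives at a point of an open set see only values nearby, so agreement on
  \<open>S\<close> passes to every iterated derivative. This lets a computed derivative replace
  \<open>frechet_derivative\<close> in the inductions below.\<close>

lemma Ck_on_cong:
  assumes "open S" "\<And>x. x \<in> S \<Longrightarrow> f x = g x" "Ck_on k f S"
  shows "Ck_on k g S"
  using assms(2,3)
proof (induction k arbitrary: f g)
  case 0
  then show ?case using continuous_on_cong[of S S f g] by simp
next
  case (Suc k)
  have d: "g differentiable at x" if "x \<in> S" for x
  proof -
    have "f differentiable at x" using Suc.prems(2) that by simp
    then show ?thesis
      unfolding differentiable_def
      using has_derivative_transform_within_open[where s = S and g = g, OF _ \<open>open S\<close> that] Suc.prems(1) by blast
  qed
  have e: "frechet_derivative f (at x) = frechet_derivative g (at x)" if "x \<in> S" for x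
    using frechet_derivative_transform_within_open[where g = g, OF _ \<open>open S\<close> that] Suc.prems that by simp
  show ?case
    using Suc.prems d e Suc.IH[of "\<lambda>x. frechet_derivative f (at x) v" "\<lambda>x. frechet_derivative g (at x) v" for v]
    by simp
qed

text \<open>The inclusion is not built into the recursion: its base case is that differentiability
  gives continuity. The product and chain rules need it for the factors that are left
  undifferentiated.\<close>

lemma Ck_on_Suc_D: "Ck_on (Suc k) f S \<Longrightarrow> Ck_on k f S"
proof (induction k arbitrary: f)
  case 0
  then show ?case
    by (simp add: differentiable_imp_continuous_on differentiable_on_def differentiable_at_withinI)
next
  case (Suc k)
  have "Ck_on k (\<lambda>x. frechet_derivative f (at x) v) S" for v
    using Suc.prems by (intro Suc.IH) (simp only: Ck_on.simps(2)[of "Suc k"])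
  then show ?case using Suc.prems by (simp only: Ck_on.simps(2)) blast
qed

lemma Ck_on_bounded_linear:
  assumes "open S" "bounded_linear L" "Ck_on k f S"
  shows "Ck_on k (\<lambda>x. L (f x)) S"
  using assms(3)
proof (induction k arbitrary: f)
  case 0
  then show ?case using assms(2) by (simp add: bounded_linear.continuous_on)
next
  case (Suc k)
  have D: "((\<lambda>x. L (f x)) has_derivative (\<lambda>v. L (frechet_derivative f (at x) v))) (at x)" if "x \<in> S" for x
    using Suc.prems that assms(2) bounded_linear.has_derivative frechet_derivative_works by fastforce
  have "Ck_on k (\<lambda>x. frechet_derivative (\<lambda>x. L (f x)) (at x) v) S" for v
    by (rule Ck_on_cong[OF assms(1) _ Suc.IH[of "\<lambda>x. frechet_derivative f (at x) v"]])
      (use Suc.prems frechet_derivative_at[OF D] in \<open>auto simp: fun_eq_iff\<close>)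
  then show ?case using D by (auto intro: differentiableI)
qed

lemma Ck_on_add:
  assumes "open S" "Ck_on k f S" "Ck_on k g S"
  shows "Ck_on k (\<lambda>x. f x + g x) S"
  using assms(2,3)
proof (induction k arbitrary: f g)
  case 0
  then show ?case by (simp add: continuous_on_add)
next
  case (Suc k)
  have D: "((\<lambda>x. f x + g x) has_derivative
      (\<lambda>v. frechet_derivative f (at x) v + frechet_derivative g (at x) v)) (at x)" if "x \<in> S" for x
    using Suc.prems that by (intro has_derivative_add) (auto simp: frechet_derivative_works[symmetric])
  have "Ck_on k (\<lambda>x. frechet_derivative (\<lambda>x. f x + g x) (at x) v) S" for v
    by (rule Ck_on_cong[OF assms(1) _ Suc.IH[of "\<lambda>x. frechet_derivative f (at x) v"
          "\<lambda>x. frechet_derivative g (at x) v"]])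
      (use Suc.prems frechet_derivative_at[OF D] in \<open>auto simp: fun_eq_iff\<close>)
  then show ?case using D by (auto intro: differentiableI)
qed

lemma Ck_on_const: "Ck_on k (\<lambda>x. c) S"
  by (induction k arbitrary: c) auto

lemma Ck_on_sum:
  assumes "open S" "\<And>i. i \<in> I \<Longrightarrow> Ck_on k (f i) S"
  shows "Ck_on k (\<lambda>x. \<Sum>i\<in>I. f i x) S"
  using assms(2)
  by (induction I rule: infinite_finite_induct) (auto intro: Ck_on_const Ck_on_add[OF assms(1)])

lemma Ck_on_scaleR:
  assumes "open S" "Ck_on k f S" "Ck_on k g S"
  shows "Ck_on k (\<lambda>x. f x *\<^sub>R g x) S"
  using assms(2,3)
proof (induction k arbitrary: f g)
  case 0
  then show ?case by (simp add: continuous_on_scaleR)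
next
  case (Suc k)
  have D: "((\<lambda>x. f x *\<^sub>R g x) has_derivative
      (\<lambda>v. f x *\<^sub>R frechet_derivative g (at x) v + frechet_derivative f (at x) v *\<^sub>R g x)) (at x)" if "x \<in> S" for x
    using Suc.prems that by (intro has_derivative_scaleR) (auto simp: frechet_derivative_works[symmetric])
  have "Ck_on k (\<lambda>x. frechet_derivative (\<lambda>x. f x *\<^sub>R g x) (at x) v) S" for v
    by (rule Ck_on_cong[OF assms(1) _ Ck_on_add[OF assms(1)
          Suc.IH[of f "\<lambda>x. frechet_derivative g (at x) v"]
          Suc.IH[of "\<lambda>x. frechet_derivative f (at x) v" g]]])
      (use Suc.prems frechet_derivative_at[OF D] Ck_on_Suc_D[OF Suc.prems(1)] Ck_on_Suc_D[OF Suc.prems(2)]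
        in \<open>auto simp: fun_eq_iff\<close>)
  then show ?case using D by (auto intro: differentiableI)
qed

lemma linear_eq_sum_Basis:
  fixes L :: "'a::euclidean_space \<Rightarrow> 'b::real_vector"
  assumes "linear L"
  shows "L v = (\<Sum>b\<in>Basis. (v \<bullet> b) *\<^sub>R L b)"
proof -
  have "L v = L (\<Sum>b\<in>Basis. (v \<bullet> b) *\<^sub>R b)" by (simp add: euclidean_representation)
  also have "\<dots> = (\<Sum>b\<in>Basis. (v \<bullet> b) *\<^sub>R L b)"
    using assms by (simp only: linear_sum linear_cmul)
  finally show ?thesis .
qed

text \<open>In the chain rule \<open>g\<close> is differentiated in a direction that moves with
  \<open>x\<close>, whereas \<open>Ck_on\<close> speaks of fixed directions only. Expanding the
  direction in the basis of the Euclidean space between the two maps removes the obstacle. The map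
  \<open>f\<close> stays fixed in the induction, because the derivatives of \<open>g\<close> are
  again composed with it.\<close>

lemma Ck_on_compose:
  fixes f :: "'a::real_normed_vector \<Rightarrow> 'b::euclidean_space"
  assumes "open S" "f ` S \<subseteq> T" "Ck_on k f S" "Ck_on k g T"
  shows "Ck_on k (\<lambda>x. g (f x)) S"
  using assms(3,4)
proof (induction k arbitrary: g)
  case 0
  then show ?case using assms(2) continuous_on_compose2[of T g S f] by simp
next
  case (Suc k)
  have D: "((\<lambda>x. g (f x)) has_derivative
      (\<lambda>v. frechet_derivative g (at (f x)) (frechet_derivative f (at x) v))) (at x)" if "x \<in> S" for x
    by (rule has_derivative_compose)
      (use Suc.prems that assms(2) in \<open>auto simp: frechet_derivative_works[symmetric]\<close>)
  have E: "frechet_derivative (\<lambda>x. g (f x)) (at x) v = (\<Sum>b\<in>Basis.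
       (frechet_derivative f (at x) v \<bullet> b) *\<^sub>R frechet_derivative g (at (f x)) b)" if "x \<in> S" for x v
  proof -
    have "linear (frechet_derivative g (at (f x)))"
      using Suc.prems that assms(2) by (auto intro!: linear_frechet_derivative)
    then show ?thesis
      by (simp add: frechet_derivative_at[OF D[OF that], symmetric]
          linear_eq_sum_Basis[of "frechet_derivative g (at (f x))" "frechet_derivative f (at x) v"])
  qed
  have "Ck_on k (\<lambda>x. frechet_derivative (\<lambda>x. g (f x)) (at x) v) S" for v
  proof (rule Ck_on_cong[OF assms(1) E[symmetric]])
    show "Ck_on k (\<lambda>x. \<Sum>b\<in>Basis. (frechet_derivative f (at x) v \<bullet> b) *\<^sub>R frechet_derivative g (at (f x)) b) S"
      using Suc.prems Ck_on_Suc_D[OF Suc.prems(1)]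
      by (intro Ck_on_sum Ck_on_scaleR assms(1) Ck_on_bounded_linear[OF _ bounded_linear_inner_left]
          Suc.IH) auto
  qed
  then show ?case using D by (auto intro: differentiableI)
qed

section \<open>Smooth functions and symmetry of second derivatives\<close>

lemma smooth_on_compose:
  fixes f :: "'a::real_normed_vector \<Rightarrow> 'b::euclidean_space"
  assumes "open S" "f ` S \<subseteq> T" "smooth_on f S" "smooth_on g T"
  shows "smooth_on (\<lambda>x. g (f x)) S"
  using assms Ck_on_compose unfolding smooth_on_def by blast

lemma smooth_on_cong:
  assumes "open S" "smooth_on f S" "\<And>x. x \<in> S \<Longrightarrow> f x = g x"
  shows "smooth_on g S"
  using assms Ck_on_cong[of S f g] unfolding smooth_on_def by blast

lemma smooth_on_frechet_derivative:
  assumes "smooth_on f S"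
  shows "smooth_on (\<lambda>x. frechet_derivative f (at x) v) S"
  using assms unfolding smooth_on_def by (metis Ck_on.simps(2))

lemma smooth_on_differentiable: "smooth_on f S \<Longrightarrow> x \<in> S \<Longrightarrow> f differentiable at x"
  unfolding smooth_on_def by (metis Ck_on.simps(2))

lemma smooth_on_continuous_on: "smooth_on f S \<Longrightarrow> continuous_on S f"
  unfolding smooth_on_def by (metis Ck_on.simps(1))

text \<open>Schwarz's theorem: the mixed second difference over a small square equals \<open>h\<^sup>2\<close> times a value of
  either mixed derivative on the square.\<close>

lemma second_difference_mvt:
  fixes f :: "'a::real_normed_vector \<Rightarrow> real"
  assumes S: "smooth_on f S" and h: "h > 0"
    and sq: "\<And>s t. 0 \<le> s \<Longrightarrow> s \<le> h \<Longrightarrow> 0 \<le> t \<Longrightarrow> t \<le> h \<Longrightarrow> x + s *\<^sub>R u + t *\<^sub>R v \<in> S"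
  shows "\<exists>s t. 0 \<le> s \<and> s \<le> h \<and> 0 \<le> t \<and> t \<le> h \<and>
     f (x + h *\<^sub>R u + h *\<^sub>R v) - f (x + h *\<^sub>R u) - f (x + h *\<^sub>R v) + f x =
     h * h * frechet_derivative (\<lambda>y. frechet_derivative f (at y) u) (at (x + s *\<^sub>R u + t *\<^sub>R v)) v"
proof -
  \<comment> \<open>The second difference is the increment of \<open>g\<close> over
    \<open>[0, h]\<close>; a mean value in \<open>s\<close> and then one in \<open>t\<close> produce
    the two derivatives in the order required.\<close>
  define g where "g s = f (x + s *\<^sub>R u + h *\<^sub>R v) - f (x + s *\<^sub>R u)" for s
  let ?D = "\<lambda>y w. frechet_derivative f (at y) w"
  have fd: "(f has_derivative ?D y) (at y)" if "y \<in> S" for y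
    using smooth_on_differentiable[OF S that] frechet_derivative_works by blast
  have lin: "linear (?D y)" if "y \<in> S" for y
    using fd[OF that] has_derivative_linear by blast
  have g': "(g has_real_derivative (?D (x + s *\<^sub>R u + h *\<^sub>R v) u - ?D (x + s *\<^sub>R u) u)) (at s)"
    if "0 \<le> s" "s \<le> h" for s
  proof -
    have a: "x + s *\<^sub>R u + h *\<^sub>R v \<in> S" "x + s *\<^sub>R u \<in> S" using sq[of s h] sq[of s 0] that h by auto
    have "(g has_derivative (\<lambda>r. ?D (x + s *\<^sub>R u + h *\<^sub>R v) (r *\<^sub>R u) - ?D (x + s *\<^sub>R u) (r *\<^sub>R u))) (at s)"
      unfolding g_def
      by (rule has_derivative_diff; rule has_derivative_compose[OF _ fd]) (auto intro!: derivative_eq_intros a)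
    moreover have "(\<lambda>r. ?D (x + s *\<^sub>R u + h *\<^sub>R v) (r *\<^sub>R u) - ?D (x + s *\<^sub>R u) (r *\<^sub>R u))
        = (*) (?D (x + s *\<^sub>R u + h *\<^sub>R v) u - ?D (x + s *\<^sub>R u) u)"
      by (simp add: fun_eq_iff linear_cmul[OF lin[OF a(1)]] linear_cmul[OF lin[OF a(2)]]
          right_diff_distrib left_diff_distrib)
    ultimately show ?thesis by (simp add: has_field_derivative_def)
  qed
  obtain s where s: "0 < s" "s < h" "g h - g 0 = (h - 0) * (?D (x + s *\<^sub>R u + h *\<^sub>R v) u - ?D (x + s *\<^sub>R u) u)"
    using MVT2[OF h g'] by auto
  let ?E = "\<lambda>y. frechet_derivative (\<lambda>y. ?D y u) (at y)"
  have ed: "((\<lambda>y. ?D y u) has_derivative ?E y) (at y)" if "y \<in> S" for y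
    using smooth_on_differentiable[OF smooth_on_frechet_derivative[OF S] that] frechet_derivative_works by blast
  have k': "((\<lambda>t. ?D (x + s *\<^sub>R u + t *\<^sub>R v) u) has_real_derivative ?E (x + s *\<^sub>R u + t *\<^sub>R v) v) (at t)"
    if "0 \<le> t" "t \<le> h" for t
  proof -
    have a: "x + s *\<^sub>R u + t *\<^sub>R v \<in> S" using sq[of s t] that s by auto
    have "((\<lambda>t. ?D (x + s *\<^sub>R u + t *\<^sub>R v) u) has_derivative (\<lambda>r. ?E (x + s *\<^sub>R u + t *\<^sub>R v) (r *\<^sub>R v))) (at t)"
      by (rule has_derivative_compose[OF _ ed]) (auto intro!: derivative_eq_intros a)
    moreover have "linear (?E (x + s *\<^sub>R u + t *\<^sub>R v))" using ed[OF a] has_derivative_linear by blast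
    then have "(\<lambda>r. ?E (x + s *\<^sub>R u + t *\<^sub>R v) (r *\<^sub>R v)) = (*) (?E (x + s *\<^sub>R u + t *\<^sub>R v) v)"
      by (simp add: fun_eq_iff linear_cmul)
    ultimately show ?thesis by (simp add: has_field_derivative_def)
  qed
  obtain t where t: "0 < t" "t < h"
    "?D (x + s *\<^sub>R u + h *\<^sub>R v) u - ?D (x + s *\<^sub>R u + 0 *\<^sub>R v) u = (h - 0) * ?E (x + s *\<^sub>R u + t *\<^sub>R v) v"
    using MVT2[OF h k'] by auto
  have "f (x + h *\<^sub>R u + h *\<^sub>R v) - f (x + h *\<^sub>R u) - f (x + h *\<^sub>R v) + f x = g h - g 0"
    by (simp add: g_def)
  also have "\<dots> = h * h * ?E (x + s *\<^sub>R u + t *\<^sub>R v) v" using s t by simp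
  finally show ?thesis using s t by (intro exI[of _ s] exI[of _ t]) auto
qed

text \<open>The second difference is symmetric in \<open>u\<close> and \<open>v\<close>, so on every
  small square some value of one mixed derivative equals some value of the other. Both are
  continuous at \<open>x\<close>, and shrinking the square gives equality there.\<close>

lemma second_derivative_symmetric_real:
  fixes f :: "'a::real_normed_vector \<Rightarrow> real"
  assumes S: "smooth_on f S" "open S" "x \<in> S"
  shows "frechet_derivative (\<lambda>y. frechet_derivative f (at y) u) (at x) v
       = frechet_derivative (\<lambda>y. frechet_derivative f (at y) v) (at x) u"
proof -
  let ?H = "\<lambda>u v y. frechet_derivative (\<lambda>y. frechet_derivative f (at y) u) (at y) v"
  have cont: "isCont (?H u v) x" for u v
    using smooth_on_continuous_on[OF smooth_on_frechet_derivative[OF smooth_on_frechet_derivative[OF S(1)]]] S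
    by (meson continuous_on_eq_continuous_at)
  obtain r where r: "r > 0" "ball x r \<subseteq> S" using S openE by blast
  have "dist (?H u v x) (?H v u x) \<le> e" if "e > 0" for e
  proof -
    obtain d1 where d1: "d1 > 0" "\<And>y. dist y x < d1 \<Longrightarrow> dist (?H u v y) (?H u v x) < e/2"
      using cont[of u v] \<open>e > 0\<close> unfolding continuous_at_eps_delta by (metis half_gt_zero)
    obtain d2 where d2: "d2 > 0" "\<And>y. dist y x < d2 \<Longrightarrow> dist (?H v u y) (?H v u x) < e/2"
      using cont[of v u] \<open>e > 0\<close> unfolding continuous_at_eps_delta by (metis half_gt_zero)
    define m where "m = Min {r, d1, d2}"
    have m: "m > 0" "m \<le> r" "m \<le> d1" "m \<le> d2" using r d1 d2 by (auto simp: m_def)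
    \<comment> \<open>This size keeps the parallelogram spanned by \<open>h\<close> times
      \<open>u\<close> and \<open>v\<close> within distance \<open>m\<close> of \<open>x\<close>;
      the summand 1 keeps the denominator positive when both vectors vanish.\<close>
    define h where "h = m / (2 * (norm u + norm v + 1))"
    have h: "h > 0" using m by (simp add: h_def add_nonneg_pos)
    \<comment> \<open>Only the sum of the two norms enters, so one estimate serves \<open>u\<close>,
      \<open>v\<close> in either order.\<close>
    have near: "dist (x + s *\<^sub>R a + t *\<^sub>R b) x < m"
      if "0 \<le> s" "s \<le> h" "0 \<le> t" "t \<le> h" "norm a + norm b = norm u + norm v" for s t a b
    proof -
      have "norm (s *\<^sub>R a + t *\<^sub>R b) \<le> h * norm a + h * norm b"
        using that h by (intro order.trans[OF norm_triangle_ineq] add_mono) (auto intro: mult_right_mono)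
      also have "\<dots> = h * (norm u + norm v)" using that by (metis distrib_left)
      also have "\<dots> < h * (2 * (norm u + norm v + 1))"
        using h norm_ge_zero[of u] norm_ge_zero[of v] by (intro mult_strict_left_mono) (auto simp: add_pos_nonneg add_nonneg_pos)
      also have "\<dots> = m"
      proof -
        have "2 * (norm u + norm v + 1) > 0"
          by (intro mult_pos_pos add_nonneg_pos add_nonneg_nonneg) auto
        then show ?thesis unfolding h_def by simp
      qed
      finally show ?thesis by (simp add: dist_norm add.assoc)
    qed
    have inS: "x + s *\<^sub>R a + t *\<^sub>R b \<in> S"
      if "0 \<le> s" "s \<le> h" "0 \<le> t" "t \<le> h" "norm a + norm b = norm u + norm v" for s t a b
    proof -
      have "dist x (x + s *\<^sub>R a + t *\<^sub>R b) < r" using near[OF that] m by (simp add: dist_commute)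
      then show ?thesis using r by auto
    qed
    obtain s t where st: "0 \<le> s" "s \<le> h" "0 \<le> t" "t \<le> h"
      "f (x + h *\<^sub>R u + h *\<^sub>R v) - f (x + h *\<^sub>R u) - f (x + h *\<^sub>R v) + f x = h * h * ?H u v (x + s *\<^sub>R u + t *\<^sub>R v)"
      using second_difference_mvt[OF S(1) h, of x u v] inS by auto
    obtain s' t' where st': "0 \<le> s'" "s' \<le> h" "0 \<le> t'" "t' \<le> h"
      "f (x + h *\<^sub>R v + h *\<^sub>R u) - f (x + h *\<^sub>R v) - f (x + h *\<^sub>R u) + f x = h * h * ?H v u (x + s' *\<^sub>R v + t' *\<^sub>R u)"
      using second_difference_mvt[OF S(1) h, of x v u] inS by auto
    have "f (x + h *\<^sub>R u + h *\<^sub>R v) = f (x + h *\<^sub>R v + h *\<^sub>R u)" by (simp add: algebra_simps)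
    then have "h * h * ?H u v (x + s *\<^sub>R u + t *\<^sub>R v) = h * h * ?H v u (x + s' *\<^sub>R v + t' *\<^sub>R u)"
      using st(5) st'(5) by linarith
    then have "?H u v (x + s *\<^sub>R u + t *\<^sub>R v) = ?H v u (x + s' *\<^sub>R v + t' *\<^sub>R u)" using h by simp
    moreover have "dist (?H u v (x + s *\<^sub>R u + t *\<^sub>R v)) (?H u v x) < e/2"
      using near[of s t u v] st m by (intro d1) auto
    moreover have "dist (?H v u (x + s' *\<^sub>R v + t' *\<^sub>R u)) (?H v u x) < e/2"
      using near[of s' t' v u] st' m by (intro d2) auto
    moreover have "dist a c \<le> e" if "y = y'" "dist y a < e/2" "dist y' c < e/2" for y y' a c :: real
      using that dist_triangle3[of a c y] by simp
    ultimately show ?thesis by metis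
  qed
  then have "dist (?H u v x) (?H v u x) \<le> 0" by (rule field_le_epsilon) simp
  then show ?thesis by simp
qed

text \<open>Pairing with a basis vector commutes with both derivatives, which reduces the claim to
  real-valued functions.\<close>

lemma second_derivative_symmetric:
  fixes f :: "'a::real_normed_vector \<Rightarrow> 'b::euclidean_space"
  assumes S: "smooth_on f S" "open S" "x \<in> S"
  shows "frechet_derivative (\<lambda>y. frechet_derivative f (at y) u) (at x) v
       = frechet_derivative (\<lambda>y. frechet_derivative f (at y) v) (at x) u"
proof (rule euclidean_eqI)
  fix b :: 'b assume "b \<in> Basis"
  have sb: "smooth_on (\<lambda>x. f x \<bullet> b) S"
    using S Ck_on_bounded_linear[OF S(2) bounded_linear_inner_left] unfolding smooth_on_def by blast
  have D1: "frechet_derivative (\<lambda>x. g x \<bullet> b) (at y) w = frechet_derivative g (at y) w \<bullet> b"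
    if "g differentiable at y" for g :: "'a \<Rightarrow> 'b" and y w
  proof -
    have "((\<lambda>x. g x \<bullet> b) has_derivative (\<lambda>w. frechet_derivative g (at y) w \<bullet> b)) (at y)"
      using that by (auto intro!: derivative_eq_intros simp: frechet_derivative_works)
    then show ?thesis using frechet_derivative_at by metis
  qed
  have D2: "frechet_derivative (\<lambda>y. frechet_derivative f (at y) u) (at x) v \<bullet> b
      = frechet_derivative (\<lambda>y. frechet_derivative (\<lambda>x. f x \<bullet> b) (at y) u) (at x) v" for u v
  proof -
    have "frechet_derivative (\<lambda>y. frechet_derivative f (at y) u) (at x) v \<bullet> b
      = frechet_derivative (\<lambda>y. frechet_derivative f (at y) u \<bullet> b) (at x) v"
      by (rule D1[symmetric]) (metis S smooth_on_frechet_derivative smooth_on_differentiable)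
    also have "frechet_derivative (\<lambda>y. frechet_derivative f (at y) u \<bullet> b) (at x)
       = frechet_derivative (\<lambda>y. frechet_derivative (\<lambda>x. f x \<bullet> b) (at y) u) (at x)"
    proof (rule frechet_derivative_transform_within_open[OF _ S(2,3)])
      show "(\<lambda>y. frechet_derivative f (at y) u \<bullet> b) differentiable at x"
        using smooth_on_differentiable[OF smooth_on_frechet_derivative[OF S(1)] S(3)]
        by (auto intro!: differentiable_inner)
      show "\<And>y. y \<in> S \<Longrightarrow> frechet_derivative f (at y) u \<bullet> b = frechet_derivative (\<lambda>x. f x \<bullet> b) (at y) u"
        using S D1 smooth_on_differentiable by metis
    qed
    finally show ?thesis .
  qed
  show "frechet_derivative (\<lambda>y. frechet_derivative f (at y) u) (at x) v \<bullet> b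
      = frechet_derivative (\<lambda>y. frechet_derivative f (at y) v) (at x) u \<bullet> b"
    unfolding D2 by (rule second_derivative_symmetric_real[OF sb S(2,3)])
qed


section \<open>Inner forms and Christoffel symbols\<close>

lemma inner_formD:
  assumes "inner_form b"
  shows "bilinear b" "b u v = b v u" "u \<noteq> 0 \<Longrightarrow> b u u > 0" "linear (b u)" "linear (\<lambda>u. b u v)"
  using assms by (auto simp: inner_form_def bilinear_def)

lemma inner_form_eq_0: "inner_form b \<Longrightarrow> b u u = 0 \<Longrightarrow> u = 0"
  by (metis inner_formD(3) less_irrefl)

lemma inner_form_ext:
  assumes "inner_form b" "\<And>w. b u w = b v w"
  shows "u = v"
proof -
  have "b (u - v) (u - v) = 0"
    using assms by (simp add: linear_diff[OF inner_formD(5)[OF assms(1)]])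
  then show ?thesis using inner_form_eq_0[OF assms(1)] by force
qed

text \<open>Riesz representation in finite dimension: \<open>T\<close> lists the values of
  \<open>b u\<close> on the basis, definiteness makes it injective, and an injective linear
  endomorphism is surjective.\<close>

lemma inner_form_represent:
  fixes b :: "'a::euclidean_space \<Rightarrow> 'a \<Rightarrow> real"
  assumes b: "inner_form b" and l: "linear l"
  shows "\<exists>u. \<forall>v. b u v = l v"
proof -
  define T where "T u = (\<Sum>i\<in>Basis. b u i *\<^sub>R i)" for u
  have T: "T u \<bullet> i = b u i" if "i \<in> Basis" for u i
    using that by (simp add: T_def inner_sum_left inner_Basis if_distrib cong: if_cong)
  have lT: "linear T"
    by (rule linearI; rule euclidean_eqI)
      (simp_all add: T inner_add_left linear_add[OF inner_formD(5)[OF b]] linear_cmul[OF inner_formD(5)[OF b]])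
  have "T u = 0 \<Longrightarrow> u = 0" for u
  proof -
    assume "T u = 0"
    then have "b u i = 0" if "i \<in> Basis" for i using T[OF that, of u] by simp
    then have "b u u = 0"
      using linear_eq_sum_Basis[OF inner_formD(4)[OF b, of u], of u] by simp
    then show "u = 0" using inner_form_eq_0[OF b] by simp
  qed
  then have "inj T" using linear_injective_0[OF lT] by blast
  then obtain u where u: "T u = (\<Sum>i\<in>Basis. l i *\<^sub>R i)"
    using linear_injective_imp_surjective[OF lT] by (metis surjD)
  have "b u v = l v" for v
  proof -
    have "b u i = l i" if "i \<in> Basis" for i
      using T[OF that, of u] that u by (simp add: inner_sum_left inner_Basis if_distrib cong: if_cong)
    then show ?thesis
      using linear_eq_sum_Basis[OF inner_formD(4)[OF b, of u], of v] linear_eq_sum_Basis[OF l, of v] by simp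
  qed
  then show ?thesis by blast
qed

text \<open>\<open>orth_proj\<close> is a definite description, so existence and uniqueness must be
  shown before anything can be said about it. The projection is found in the Euclidean domain of
  \<open>L\<close>: injectivity makes the pulled-back form positive definite, and there
  \<open>inner_form_represent\<close> applies.\<close>

lemma orth_proj_range_mem:
  fixes L :: "'a::euclidean_space \<Rightarrow> 'b::real_vector"
  assumes b: "inner_form b" and L: "linear L" "inj L"
  shows "orth_proj b (range L) w \<in> range L"
proof -
  note lin = linear_add[OF inner_formD(4)[OF b]] linear_cmul[OF inner_formD(4)[OF b]]
    linear_add[OF inner_formD(5)[OF b]] linear_cmul[OF inner_formD(5)[OF b]]
    linear_diff[OF inner_formD(5)[OF b]] linear_add[OF L(1)] linear_cmul[OF L(1)]
  have L0: "L u \<noteq> 0" if "u \<noteq> 0" for u using that L by (metis injD linear_0)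
  have "bilinear (\<lambda>u v. b (L u) (L v))"
    unfolding bilinear_def by (intro conjI allI linearI) (simp_all add: lin)
  then have 1: "inner_form (\<lambda>u v. b (L u) (L v))"
    using inner_formD(2,3)[OF b] L0 unfolding inner_form_def by metis
  have 2: "linear (\<lambda>v. b w (L v))" by (intro linearI) (simp_all add: lin)
  obtain u where u: "\<And>v. b (L u) (L v) = b w (L v)"
    using inner_form_represent[OF 1 2] by blast
  have "\<exists>!e. e \<in> range L \<and> (\<forall>z\<in>range L. b (w - e) z = 0)"
  proof (rule ex1I[of _ "L u"])
    show "L u \<in> range L \<and> (\<forall>z\<in>range L. b (w - L u) z = 0)" by (auto simp: lin u)
    fix e assume e: "e \<in> range L \<and> (\<forall>z\<in>range L. b (w - e) z = 0)"
    then obtain a where a: "e = L a" by blast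
    have "L a - L u \<in> range L" using L(1) by (metis linear_diff rangeI)
    then have "b (w - L a) (L a - L u) = 0" "b (w - L u) (L a - L u) = 0"
      using e a u by (auto simp: lin)
    then have "b (L a - L u) (L a - L u) = 0" by (simp add: lin)
    then have "L a - L u = 0" by (rule inner_form_eq_0[OF b])
    then show "e = L u" using a by simp
  qed
  from theI'[OF this] show ?thesis unfolding orth_proj_def by blast
qed

text \<open>A product rule that asks for differentiability of \<open>L\<close> only at each fixed
  vector; the basis expansion turns \<open>L x (a x)\<close> into a finite sum of ordinary
  products.\<close>

lemma has_derivative_pairing_linear:
  fixes L :: "'x::real_normed_vector \<Rightarrow> 'a::euclidean_space \<Rightarrow> 'c::real_normed_vector"
  assumes S: "open S" "x0 \<in> S" and lin: "\<And>x. x \<in> S \<Longrightarrow> linear (L x)"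
    and D: "\<And>v. ((\<lambda>x. L x v) has_derivative L' v) (at x0)"
    and a: "(a has_derivative a') (at x0)"
  shows "((\<lambda>x. L x (a x)) has_derivative (\<lambda>u. L' (a x0) u + L x0 (a' u))) (at x0)"
proof -
  \<comment> \<open>Linearity of \<open>L x\<close> near \<open>x0\<close> is inherited by
    \<open>L'\<close> through uniqueness of derivatives.\<close>
  have L': "L' v u = (\<Sum>i\<in>Basis. (v \<bullet> i) *\<^sub>R L' i u)" for v u
  proof -
    have "((\<lambda>x. \<Sum>i\<in>Basis. (v \<bullet> i) *\<^sub>R L x i) has_derivative (\<lambda>u. \<Sum>i\<in>Basis. (v \<bullet> i) *\<^sub>R L' i u)) (at x0)"
      by (intro has_derivative_sum has_derivative_scaleR_right D)
    then have "((\<lambda>x. L x v) has_derivative (\<lambda>u. \<Sum>i\<in>Basis. (v \<bullet> i) *\<^sub>R L' i u)) (at x0)"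
      by (rule has_derivative_transform_within_open[OF _ S]) (metis lin linear_eq_sum_Basis)
    from has_derivative_unique[OF D this] show ?thesis by (rule fun_cong)
  qed
  have "((\<lambda>x. \<Sum>i\<in>Basis. (a x \<bullet> i) *\<^sub>R L x i) has_derivative
      (\<lambda>u. \<Sum>i\<in>Basis. (a x0 \<bullet> i) *\<^sub>R L' i u + (a' u \<bullet> i) *\<^sub>R L x0 i)) (at x0)"
    by (intro has_derivative_sum has_derivative_scaleR D has_derivative_inner_left a)
  then have "((\<lambda>x. L x (a x)) has_derivative
      (\<lambda>u. \<Sum>i\<in>Basis. (a x0 \<bullet> i) *\<^sub>R L' i u + (a' u \<bullet> i) *\<^sub>R L x0 i)) (at x0)"
    by (rule has_derivative_transform_within_open[OF _ S]) (metis lin linear_eq_sum_Basis)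
  moreover have "(\<Sum>i\<in>Basis. (a x0 \<bullet> i) *\<^sub>R L' i u + (a' u \<bullet> i) *\<^sub>R L x0 i) = L' (a x0) u + L x0 (a' u)" for u
    by (simp add: sum.distrib L'[symmetric] linear_eq_sum_Basis[OF lin[OF S(2)], symmetric])
  ultimately show ?thesis by simp
qed

lemma has_derivative_pairing_bilinear:
  fixes K :: "'x::real_normed_vector \<Rightarrow> 'a::euclidean_space \<Rightarrow> 'b::euclidean_space \<Rightarrow> 'c::real_normed_vector"
  assumes S: "open S" "x0 \<in> S" and bil: "\<And>x. x \<in> S \<Longrightarrow> bilinear (K x)"
    and D: "\<And>v w. ((\<lambda>x. K x v w) has_derivative K' v w) (at x0)"
    and a: "(a has_derivative a') (at x0)" and b: "(b has_derivative b') (at x0)"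
  shows "((\<lambda>x. K x (a x) (b x)) has_derivative
     (\<lambda>u. K' (a x0) (b x0) u + K x0 (a' u) (b x0) + K x0 (a x0) (b' u))) (at x0)"
proof -
  have l: "linear (K x v)" "linear (\<lambda>v. K x v w)" if "x \<in> S" for x v w
    using bil[OF that] by (auto simp: bilinear_def)
  have "((\<lambda>x. K x v (b x)) has_derivative (\<lambda>u. K' v (b x0) u + K x0 v (b' u))) (at x0)" for v
    using l by (intro has_derivative_pairing_linear[OF S _ _ b] D) auto
  from has_derivative_pairing_linear[where L = "\<lambda>x v. K x v (b x)", OF S l(2) this a] show ?thesis
    by (simp add: add_ac)
qed

text \<open>The fundamental theorem of Riemannian geometry at one point. Alternating the metric
  condition over three vectors gives Koszul's formula, which forces uniqueness; conversely its
  right-hand side, represented by the metric, defines a solution, so the description in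
  \<open>christoffel\<close> is proper.\<close>

lemma christoffel_form_koszul:
  assumes S: "open S" "x \<in> S" and ip: "\<And>y. y \<in> S \<Longrightarrow> inner_form (metric_in M c y)"
    and D: "\<And>v w. (\<lambda>y. metric_in M c y v w) differentiable at x"
  shows "christoffel_form M c x (christoffel M c x)"
    and "christoffel_form M c x G \<Longrightarrow> 2 * metric_in M c x (G u v) w =
      frechet_derivative (\<lambda>y. metric_in M c y v w) (at x) u
    + frechet_derivative (\<lambda>y. metric_in M c y u w) (at x) v
    - frechet_derivative (\<lambda>y. metric_in M c y u v) (at x) w"
proof -
  let ?g = "metric_in M c x"
  let ?D = "\<lambda>u v w. frechet_derivative (\<lambda>y. metric_in M c y v w) (at x) u"
  have fd: "((\<lambda>y. metric_in M c y v w) has_derivative (\<lambda>u. ?D u v w)) (at x)" for v w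
    using D frechet_derivative_works by blast
  have Dl1: "linear (\<lambda>u. ?D u v w)" for v w using fd has_derivative_linear by blast
  have gl: "linear (metric_in M c y v)" "metric_in M c y v w = metric_in M c y w v" if "y \<in> S" for y v w
    using inner_formD[OF ip[OF that]] by auto
  have Dsym: "?D u v w = ?D u w v" for u v w
    by (subst frechet_derivative_transform_within_open[OF D S]) (auto simp: gl)
  have Dadd: "?D u v (w + w') = ?D u v w + ?D u v w'" for u v w w'
  proof -
    have "((\<lambda>y. metric_in M c y v (w + w')) has_derivative (\<lambda>u. ?D u v w + ?D u v w')) (at x)"
      by (rule has_derivative_transform_within_open[OF has_derivative_add[OF fd fd] S])
        (simp add: linear_add[OF gl(1)])
    from has_derivative_unique[OF fd this] show ?thesis by (rule fun_cong)
  qed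
  have Dcmul: "?D u v (r *\<^sub>R w) = r * ?D u v w" for u v w r
  proof -
    have "((\<lambda>y. metric_in M c y v (r *\<^sub>R w)) has_derivative (\<lambda>u. r * ?D u v w)) (at x)"
      by (rule has_derivative_transform_within_open[OF has_derivative_mult_right[OF fd] S])
        (simp add: linear_cmul[OF gl(1)])
    from has_derivative_unique[OF fd this] show ?thesis by (rule fun_cong)
  qed
  define D where "D u v w = ?D u v w" for u v w
  have Ds: "D u v w = D u w v" for u v w by (simp add: D_def Dsym)
  have D3: "D u v (w + w') = D u v w + D u v w'" "D u v (r *\<^sub>R w) = r * D u v w" for u v w w' r
    by (simp_all add: D_def Dadd Dcmul)
  have D2: "D u (v + v') w = D u v w + D u v' w" "D u (r *\<^sub>R v) w = r * D u v w" for u v v' w r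
    using D3 Ds by metis+
  have D1: "D (u + u') v w = D u v w + D u' v w" "D (r *\<^sub>R u) v w = r * D u v w" for u u' v w r
    by (simp_all add: D_def linear_add[OF Dl1] linear_cmul[OF Dl1])
  have gx: "inner_form ?g" using ip S by blast
  note glin = linear_add[OF inner_formD(4)[OF gx]] linear_cmul[OF inner_formD(4)[OF gx]]
    linear_add[OF inner_formD(5)[OF gx]] linear_cmul[OF inner_formD(5)[OF gx]]
  show kosz: "2 * ?g (G u v) w = ?D u v w + ?D v u w - ?D w u v" if "christoffel_form M c x G" for G u v w
  proof -
    have 1: "?D u v w = ?g (G u v) w + ?g v (G u w)" "G u v = G v u" for u v w
      using that by (auto simp: christoffel_form_def)
    have "?D v u w = ?g (G u v) w + ?g u (G v w)" "?D w u v = ?g v (G u w) + ?g u (G v w)"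
      using 1 inner_formD(2)[OF gx] by metis+
    then show ?thesis using 1(1)[where u = u and v = v and w = w] by linarith
  qed
  \<comment> \<open>Half of the right-hand side of Koszul's formula. It is linear in
    \<open>w\<close>, hence represented by a vector \<open>G0 u v\<close>.\<close>
  define K where "K u v w = (D u v w + D v u w - D w u v) / 2" for u v w
  have Ka: "K u v (w + w') = K u v w + K u v w'" "K u (v + v') w = K u v w + K u v' w"
    "K u v w = K v u w" "K u v (r *\<^sub>R w) = r * K u v w" "K u (r *\<^sub>R v) w = r * K u v w" for u v w w' v' r
    by (simp_all add: K_def D1 D2 D3 Ds[of w u v] field_simps)
  have "linear (K u v)" for u v by (rule linearI) (simp_all add: Ka)
  then have "\<exists>a. \<forall>w. ?g a w = K u v w" for u v using inner_form_represent[OF gx] by blast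
  then obtain G0 where G0: "\<And>u v w. ?g (G0 u v) w = K u v w" by metis
  have 1: "G0 u (v + v') = G0 u v + G0 u v'" for u v v'
    by (rule inner_form_ext[OF gx]) (simp add: G0 glin Ka)
  have 2: "G0 u (r *\<^sub>R v) = r *\<^sub>R G0 u v" for u v r
    by (rule inner_form_ext[OF gx]) (simp add: G0 glin Ka)
  have 3: "G0 u v = G0 v u" for u v
    by (rule inner_form_ext[OF gx]) (simp add: G0 Ka)
  have "bilinear G0"
  proof -
    have "G0 (u + u') v = G0 u v + G0 u' v" "G0 (r *\<^sub>R u) v = r *\<^sub>R G0 u v" for u u' v r
      using 1 2 3 by metis+
    then show ?thesis unfolding bilinear_def by (auto intro!: linearI simp: 1 2)
  qed
  moreover have "?D u v w = ?g (G0 u v) w + ?g v (G0 u w)" for u v w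
    using inner_formD(2)[OF gx, of v "G0 u w"] Ds[of w u v] Ds[of v u w] Ds[of u v w]
    by (simp add: G0 K_def D_def[symmetric] field_simps)
  ultimately have cf: "christoffel_form M c x G0" using 3 by (simp add: christoffel_form_def)
  have "G = G0" if "christoffel_form M c x G" for G
  proof (intro ext inner_form_ext[OF gx])
    fix u v w show "?g (G u v) w = ?g (G0 u v) w" using kosz[OF that, of u v w] kosz[OF cf, of u v w] by simp
  qed
  with cf show "christoffel_form M c x (christoffel M c x)"
    unfolding christoffel_def by (rule theI)
qed


section \<open>Charts and tangent maps\<close>

text \<open>For the product atlas first-order compatibility of the charts suffices: the higher derivatives
  that occur are those of the immersion and of the metric of the ambient manifold.\<close>

definition diff_atlas :: "('m::topological_space, 'a::euclidean_space) chart set \<Rightarrow> bool" where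
  "diff_atlas A \<longleftrightarrow>
     (\<Union>c\<in>A. cdom c) = UNIV \<and>
     (\<forall>c\<in>A. open (cdom c) \<and> open (cran c) \<and> homeomorphism (cdom c) (cran c) (cmap c) (cinv c)) \<and>
     (\<forall>c\<in>A. \<forall>d\<in>A. \<forall>p\<in>cdom c \<inter> cdom d. transition c d differentiable at (cmap c p))"

lemma smooth_atlas_diff_atlas: "smooth_atlas A \<Longrightarrow> diff_atlas A"
  unfolding smooth_atlas_def diff_atlas_def by (meson imageI smooth_on_differentiable)

lemma chart_at:
  assumes "diff_atlas A"
  shows "chart_at A p \<in> A" "p \<in> cdom (chart_at A p)"
proof -
  have "\<exists>c. c \<in> A \<and> p \<in> cdom c" using assms unfolding diff_atlas_def by blast
  from someI_ex[OF this] show "chart_at A p \<in> A" "p \<in> cdom (chart_at A p)"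
    unfolding chart_at_def by auto
qed

lemma diff_atlasD:
  assumes "diff_atlas A" "c \<in> A"
  shows "open (cdom c)" "open (cran c)" "homeomorphism (cdom c) (cran c) (cmap c) (cinv c)"
    "p \<in> cdom c \<Longrightarrow> cinv c (cmap c p) = p"
  using assms unfolding diff_atlas_def by (auto dest!: homeomorphism_apply1)

lemma open_chart_image:
  assumes "diff_atlas A" "c \<in> A" "open W"
  shows "open (cmap c ` (cdom c \<inter> W))"
proof -
  have "open (cran c \<inter> cinv c -` W)"
    using diff_atlasD[OF assms(1,2)] assms(3)
    by (intro continuous_open_preimage) (auto dest: homeomorphism_cont2)
  moreover have "cran c \<inter> cinv c -` W = cmap c ` (cdom c \<inter> W)"
    using diff_atlasD(4)[OF assms(1,2)] by auto
  ultimately show ?thesis by simp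
qed

lemma transition_has_derivative:
  assumes "diff_atlas A" "c \<in> A" "d \<in> A" "p \<in> cdom c" "p \<in> cdom d"
  shows "(transition c d has_derivative frechet_derivative (transition c d) (at (cmap c p))) (at (cmap c p))"
  using assms unfolding diff_atlas_def by (auto simp: frechet_derivative_works[symmetric])

text \<open>The chain rule for transition maps, which compose correctly on a neighbourhood of the
  common point.\<close>

lemma transition_cocycle:
  assumes A: "diff_atlas A" and c: "c \<in> A" "d \<in> A" "e \<in> A" and p: "p \<in> cdom c" "p \<in> cdom d" "p \<in> cdom e"
  shows "frechet_derivative (transition d e) (at (cmap d p)) (frechet_derivative (transition c d) (at (cmap c p)) w)
    = frechet_derivative (transition c e) (at (cmap c p)) w"
proof -
  have t: "transition c d (cmap c p) = cmap d p" using p diff_atlasD(4)[OF A c(1)] by (simp add: transition_def)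
  have "((\<lambda>x. transition d e (transition c d x)) has_derivative
    (\<lambda>w. frechet_derivative (transition d e) (at (cmap d p)) (frechet_derivative (transition c d) (at (cmap c p)) w)))
    (at (cmap c p))"
    using has_derivative_compose[OF transition_has_derivative[OF A c(1,2) p(1,2)], of "transition d e"]
      transition_has_derivative[OF A c(2,3) p(2,3)] by (simp add: t)
  moreover have "open (cmap c ` (cdom c \<inter> cdom d))"
    by (rule open_chart_image[OF A c(1) diff_atlasD(1)[OF A c(2)]])
  ultimately have "(transition c e has_derivative
    (\<lambda>w. frechet_derivative (transition d e) (at (cmap d p)) (frechet_derivative (transition c d) (at (cmap c p)) w)))
    (at (cmap c p))"
    by (rule has_derivative_transform_within_open)
      (use p diff_atlasD(4)[OF A c(1)] diff_atlasD(4)[OF A c(2)] in \<open>auto simp: transition_def\<close>)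
  from frechet_derivative_at[OF this] show ?thesis by metis
qed

lemma transition_self_derivative:
  assumes A: "diff_atlas A" and c: "c \<in> A" and p: "p \<in> cdom c"
  shows "frechet_derivative (transition c c) (at (cmap c p)) w = w"
proof -
  have "(transition c c has_derivative (\<lambda>w. w)) (at (cmap c p))"
    by (rule has_derivative_transform_within_open[OF has_derivative_ident diff_atlasD(2)[OF A c]])
      (use p diff_atlasD(4)[OF A c] in \<open>auto simp: transition_def\<close>)
  from frechet_derivative_at[OF this] show ?thesis by metis
qed

text \<open>Both maps are derivatives of transitions, one in each direction, so the cocycle identity
  makes them mutually inverse.\<close>

lemma tvec_tcoord:
  assumes "diff_atlas A" "c \<in> A" "p \<in> cdom c"
  shows "tvec A c p (tcoord A c p u) = u" "tcoord A c p (tvec A c p u) = u"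
    "linear (tvec A c p)" "linear (tcoord A c p)"
proof -
  note ch = chart_at[OF assms(1), of p]
  show "tvec A c p (tcoord A c p u) = u" "tcoord A c p (tvec A c p u) = u"
    unfolding tvec_def tcoord_def
    using transition_cocycle[OF assms(1)] transition_self_derivative[OF assms(1)] ch assms by simp_all
  show "linear (tvec A c p)" "linear (tcoord A c p)"
    unfolding tvec_def tcoord_def
    by (rule has_derivative_linear[OF transition_has_derivative[OF assms(1)]]; use ch assms in simp)+
qed

lemma tvec_chart_at:
  assumes "diff_atlas A"
  shows "tvec A (chart_at A p) p u = u" "tcoord A (chart_at A p) p u = u"
  unfolding tvec_def tcoord_def using transition_self_derivative[OF assms] chart_at[OF assms] by auto

text \<open>\<open>differential\<close> is tied to the chosen charts; the chain rule through one
  transition on each side allows any pair of charts. Continuity of \<open>F\<close> makes the set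
  where the two coordinate expressions can be compared open.\<close>

lemma differential_in_charts:
  assumes A: "diff_atlas A" and B: "diff_atlas B" and c: "c \<in> A" "q \<in> cdom c" and d: "d \<in> B" "F q \<in> cdom d"
    and F: "continuous_on UNIV F" and L: "((\<lambda>x. cmap d (F (cinv c x))) has_derivative L) (at (cmap c q))"
  shows "differential A B F q u = tvec B d (F q) (L (tcoord A c q u))"
proof -
  define c' where "c' = chart_at A q"
  define d' where "d' = chart_at B (F q)"
  have c': "c' \<in> A" "q \<in> cdom c'" and d': "d' \<in> B" "F q \<in> cdom d'"
    unfolding c'_def d'_def using chart_at[OF A] chart_at[OF B] by auto
  note inv = diff_atlasD(4)[OF A c(1)] diff_atlasD(4)[OF A c'(1)] diff_atlasD(4)[OF B d(1)] diff_atlasD(4)[OF B d'(1)]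
  let ?t = "frechet_derivative (transition c' c) (at (cmap c' q))"
  let ?s = "frechet_derivative (transition d d') (at (cmap d (F q)))"
  have tq: "transition c' c (cmap c' q) = cmap c q" using c' inv by (simp add: transition_def)
  have "((\<lambda>x. cmap d (F (cinv c (transition c' c x)))) has_derivative (\<lambda>w. L (?t w))) (at (cmap c' q))"
    by (rule has_derivative_compose[OF transition_has_derivative[OF A c'(1) c(1) c'(2) c(2)], of "\<lambda>x. cmap d (F (cinv c x))"])
      (simp add: tq L)
  moreover have "(transition d d' has_derivative ?s) (at (cmap d (F (cinv c (transition c' c (cmap c' q))))))"
    using transition_has_derivative[OF B d(1) d'(1) d(2) d'(2)] c by (simp add: tq inv)
  ultimately have 1: "((\<lambda>x. transition d d' (cmap d (F (cinv c (transition c' c x))))) has_derivative (\<lambda>w. ?s (L (?t w)))) (at (cmap c' q))"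
    by (rule has_derivative_compose)
  have op: "open (cdom c \<inter> F -` cdom d)"
    using diff_atlasD(1)[OF A c(1)] diff_atlasD(1)[OF B d(1)] F open_vimage by blast
  have "((\<lambda>x. cmap d' (F (cinv c' x))) has_derivative (\<lambda>w. ?s (L (?t w)))) (at (cmap c' q))"
    by (rule has_derivative_transform_within_open[OF 1 open_chart_image[OF A c'(1) op]])
      (use c c' d d' inv in \<open>auto simp: transition_def\<close>)
  from frechet_derivative_at[OF this] show ?thesis
    unfolding differential_def tvec_def tcoord_def c'_def[symmetric] d'_def[symmetric] by metis
qed

lemma differential_tvec:
  assumes "diff_atlas A" "diff_atlas B" "c \<in> A" "q \<in> cdom c" "d \<in> B" "F q \<in> cdom d"
    "continuous_on UNIV F" "((\<lambda>x. cmap d (F (cinv c x))) has_derivative L) (at (cmap c q))"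
  shows "differential A B F q (tvec A c q w) = tvec B d (F q) (L w)"
  using differential_in_charts[OF assms] tvec_tcoord[OF assms(1,3,4)] by simp

lemma differential_id:
  assumes A: "diff_atlas A"
  shows "differential A A (\<lambda>q. q) p u = u"
proof -
  note c = chart_at[OF A, of p]
  have "((\<lambda>x. cmap (chart_at A p) (cinv (chart_at A p) x)) has_derivative (\<lambda>u. u)) (at (cmap (chart_at A p) p))"
    by (rule has_derivative_transform_within_open[OF has_derivative_ident diff_atlasD(2)[OF A c(1)]])
      (use c diff_atlasD(4)[OF A c(1)] in auto)
  from differential_in_charts[where F = "\<lambda>q. q", OF A A c c _ this] show ?thesis
    by (simp add: tvec_chart_at[OF A] continuous_on_id)
qed

text \<open>Supplies test fields for the condition that \<open>J\<close> is parallel. Seen from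
  another chart the components are derivatives of a transition map, so smoothness of the whole atlas
  enters here.\<close>

lemma constant_field_smooth:
  assumes B: "smooth_atlas B" and d: "d \<in> B"
  shows "smooth_field_on B (cdom d) (\<lambda>q. tvec B d q w)"
  unfolding smooth_field_on_def
proof (intro conjI ballI)
  note B' = smooth_atlas_diff_atlas[OF B]
  show "open (cdom d)" using diff_atlasD(1)[OF B' d] .
  fix c assume c: "c \<in> B"
  let ?S = "cmap c ` (cdom c \<inter> cdom d)"
  have S: "open ?S" by (rule open_chart_image[OF B' c diff_atlasD(1)[OF B' d]])
  have sm: "smooth_on (transition c d) ?S" "smooth_on (transition d c) (cmap d ` (cdom d \<inter> cdom c))"
    using B c d by (auto simp: smooth_atlas_def)
  have "transition c d ` ?S \<subseteq> cmap d ` (cdom d \<inter> cdom c)"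
    using diff_atlasD(4)[OF B' c] by (auto simp: transition_def)
  then have "smooth_on (\<lambda>x. frechet_derivative (transition d c) (at (transition c d x)) w) ?S"
    by (rule smooth_on_compose[OF S _ sm(1) smooth_on_frechet_derivative[OF sm(2)]])
  then show "smooth_on (\<lambda>x. tcoord B c (cinv c x) (tvec B d (cinv c x) w)) ?S"
  proof (rule smooth_on_cong[OF S])
    fix x assume "x \<in> ?S"
    then obtain q where q: "q \<in> cdom c" "q \<in> cdom d" "x = cmap c q" by blast
    then show "frechet_derivative (transition d c) (at (transition c d x)) w = tcoord B c (cinv c x) (tvec B d (cinv c x) w)"
      unfolding tcoord_def tvec_def using chart_at[OF B', of q] c d diff_atlasD(4)[OF B' c]
      by (simp add: transition_cocycle[OF B'] transition_def)
  qed
qed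


section \<open>Product charts\<close>

text \<open>A name for the members of \<open>product_atlas\<close>, so that their domain and
  coordinate map can be simplified.\<close>

definition prod_chart ::
  "('p, 'a) chart \<Rightarrow> ('q, 'b) chart \<Rightarrow> ('r, 'c) chart \<Rightarrow> ('p \<times> 'q \<times> 'r, 'a \<times> 'b \<times> 'c) chart" where
  "prod_chart c0 c1 c2 = (cdom c0 \<times> cdom c1 \<times> cdom c2,
     \<lambda>z. (cmap c0 (proj0 z), cmap c1 (proj1 z), cmap c2 (proj2 z)))"

lemma product_atlas_iff:
  "c \<in> product_atlas A0 A1 A2 \<longleftrightarrow> (\<exists>c0\<in>A0. \<exists>c1\<in>A1. \<exists>c2\<in>A2. c = prod_chart c0 c1 c2)"
  unfolding product_atlas_def prod_chart_def by blast

lemma prod_chart_simps [simp]: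
  "cdom (prod_chart c0 c1 c2) = cdom c0 \<times> cdom c1 \<times> cdom c2"
  "cmap (prod_chart c0 c1 c2) z = (cmap c0 (proj0 z), cmap c1 (proj1 z), cmap c2 (proj2 z))"
  by (simp_all add: prod_chart_def)

lemma cran_prod_chart: "cran (prod_chart c0 c1 c2) = cran c0 \<times> cran c1 \<times> cran c2"
  by (force simp: image_iff)

lemma cinv_prod_chart:
  assumes "diff_atlas A0" "diff_atlas A1" "diff_atlas A2" "c0 \<in> A0" "c1 \<in> A1" "c2 \<in> A2"
    and x: "x \<in> cran (prod_chart c0 c1 c2)"
  shows "cinv (prod_chart c0 c1 c2) x = (cinv c0 (fst x), cinv c1 (fst (snd x)), cinv c2 (snd (snd x)))"
proof -
  note inv = diff_atlasD(4)[OF assms(1,4)] diff_atlasD(4)[OF assms(2,5)] diff_atlasD(4)[OF assms(3,6)]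
  obtain p q r where z: "p \<in> cdom c0" "q \<in> cdom c1" "r \<in> cdom c2" "x = (cmap c0 p, cmap c1 q, cmap c2 r)"
    using x by auto
  have "inj_on (cmap (prod_chart c0 c1 c2)) (cdom (prod_chart c0 c1 c2))"
    by (rule inj_onI) (use inv in \<open>auto, metis+\<close>)
  then have "cinv (prod_chart c0 c1 c2) (cmap (prod_chart c0 c1 c2) (p, q, r)) = (p, q, r)"
    by (rule inv_into_f_f) (use z in auto)
  then show ?thesis using z inv by simp
qed

text \<open>Everything is checked factor by factor: a transition of product charts is the product of
  the three transitions, and so is its derivative.\<close>

lemma diff_atlas_product:
  fixes A0 :: "('p::topological_space, 'a::euclidean_space) chart set"
    and A1 :: "('q::topological_space, 'b::euclidean_space) chart set"
    and A2 :: "('r::topological_space, 'c::euclidean_space) chart set"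
  assumes A: "diff_atlas A0" "diff_atlas A1" "diff_atlas A2"
  shows "diff_atlas (product_atlas A0 A1 A2)"
proof -
  have cover: "\<exists>c\<in>product_atlas A0 A1 A2. z \<in> cdom c" for z
  proof -
    let ?c = "prod_chart (chart_at A0 (proj0 z)) (chart_at A1 (proj1 z)) (chart_at A2 (proj2 z))"
    have "?c \<in> product_atlas A0 A1 A2" using chart_at(1)[OF A(1)] chart_at(1)[OF A(2)] chart_at(1)[OF A(3)]
      unfolding product_atlas_iff by blast
    moreover have "z \<in> cdom ?c" using chart_at(2)[OF A(1)] chart_at(2)[OF A(2)] chart_at(2)[OF A(3)]
      by (simp add: mem_Times_iff)
    ultimately show ?thesis by blast
  qed
  have chart: "open (cdom c) \<and> open (cran c) \<and> homeomorphism (cdom c) (cran c) (cmap c) (cinv c)"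
    if "c \<in> product_atlas A0 A1 A2" for c
  proof -
    obtain c0 c1 c2 where c: "c0 \<in> A0" "c1 \<in> A1" "c2 \<in> A2" "c = prod_chart c0 c1 c2"
      using \<open>c \<in> _\<close> unfolding product_atlas_iff by blast
    note D0 = diff_atlasD[OF A(1) c(1)] and D1 = diff_atlasD[OF A(2) c(2)] and D2 = diff_atlasD[OF A(3) c(3)]
    have "open (cran c)" unfolding c(4) cran_prod_chart using D0 D1 D2 by (intro open_Times)
    moreover have "open (cdom c)" using D0 D1 D2 unfolding c(4) prod_chart_simps by (intro open_Times)
    moreover have "homeomorphism (cdom c) (cran c) (cmap c) (cinv c)"
    \<comment> \<open>\<open>cinv c\<close> agrees with the product of the three inverses only on
      the range of the chart, so the claim is proved for that explicit inverse and then
      transferred.\<close>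
    proof (rule homeomorphism_cong[OF _ refl refl])
      let ?g = "\<lambda>x. (cinv c0 (fst x), cinv c1 (fst (snd x)), cinv c2 (snd (snd x)))"
      have cg: "continuous_on (cran c) ?g" unfolding c(4) cran_prod_chart
        by (intro continuous_on_Pair continuous_on_compose2[OF homeomorphism_cont2[OF D0(3)]]
            continuous_on_compose2[OF homeomorphism_cont2[OF D1(3)]]
            continuous_on_compose2[OF homeomorphism_cont2[OF D2(3)]] continuous_intros) auto
      have cm: "continuous_on (cdom c) (\<lambda>z. (cmap c0 (proj0 z), cmap c1 (proj1 z), cmap c2 (proj2 z)))"
        unfolding c(4) prod_chart_simps
        by (intro continuous_on_Pair continuous_on_compose2[OF homeomorphism_cont1[OF D0(3)]]
            continuous_on_compose2[OF homeomorphism_cont1[OF D1(3)]]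
            continuous_on_compose2[OF homeomorphism_cont1[OF D2(3)]] continuous_intros) auto
      have cm': "cmap c = (\<lambda>z. (cmap c0 (proj0 z), cmap c1 (proj1 z), cmap c2 (proj2 z)))"
        by (simp add: c(4) fun_eq_iff)
      show "homeomorphism (cdom c) (cran c) (cmap c) ?g"
      proof (rule homeomorphismI)
        show "continuous_on (cdom c) (cmap c)" using cm cm' by simp
        show "continuous_on (cran c) ?g" by (rule cg)
        show "cmap c ` cdom c \<subseteq> cran c" by simp
        show "?g ` cran c \<subseteq> cdom c" using D0(4) D1(4) D2(4) by (auto simp: c(4))
        show "\<And>z. z \<in> cdom c \<Longrightarrow> ?g (cmap c z) = z" using D0(4) D1(4) D2(4) by (auto simp: c(4))
        show "\<And>x. x \<in> cran c \<Longrightarrow> cmap c (?g x) = x" using D0(4) D1(4) D2(4) by (auto simp: c(4))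
      qed
      show "\<And>x. x \<in> cdom c \<Longrightarrow> cmap c x = cmap c x" by simp
      show "\<And>x. x \<in> cran c \<Longrightarrow> cinv c x = ?g x"
        unfolding c(4) using cinv_prod_chart[OF A c(1-3)] by simp
    qed
    ultimately show ?thesis by blast
  qed
  have trans: "transition c d differentiable at (cmap c z)"
    if "c \<in> product_atlas A0 A1 A2" "d \<in> product_atlas A0 A1 A2" "z \<in> cdom c \<inter> cdom d" for c d z
  proof -
    obtain c0 c1 c2 where c: "c0 \<in> A0" "c1 \<in> A1" "c2 \<in> A2" "c = prod_chart c0 c1 c2"
      using \<open>c \<in> _\<close> unfolding product_atlas_iff by blast
    obtain d0 d1 d2 where d: "d0 \<in> A0" "d1 \<in> A1" "d2 \<in> A2" "d = prod_chart d0 d1 d2"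
      using \<open>d \<in> _\<close> unfolding product_atlas_iff by blast
    obtain L0 L1 L2 where L:
      "(transition c0 d0 has_derivative L0) (at (fst (cmap c z)))"
      "(transition c1 d1 has_derivative L1) (at (fst (snd (cmap c z))))"
      "(transition c2 d2 has_derivative L2) (at (snd (snd (cmap c z))))"
      using transition_has_derivative[OF A(1) c(1) d(1), of "proj0 z"]
        transition_has_derivative[OF A(2) c(2) d(2), of "proj1 z"]
        transition_has_derivative[OF A(3) c(3) d(3), of "proj2 z"] \<open>z \<in> _\<close> c(4) d(4) by auto
    have "((\<lambda>x. (transition c0 d0 (fst x), transition c1 d1 (fst (snd x)), transition c2 d2 (snd (snd x))))
      has_derivative (\<lambda>u. (L0 (fst u), L1 (fst (snd u)), L2 (snd (snd u))))) (at (cmap c z))"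
      by (intro has_derivative_Pair has_derivative_compose[where f = fst, OF _ L(1)]
          has_derivative_compose[where f = "\<lambda>x. fst (snd x)", OF _ L(2)]
          has_derivative_compose[where f = "\<lambda>x. snd (snd x)", OF _ L(3)]
          has_derivative_fst has_derivative_snd has_derivative_ident)
    then have "(transition c d has_derivative (\<lambda>u. (L0 (fst u), L1 (fst (snd u)), L2 (snd (snd u))))) (at (cmap c z))"
    proof (rule has_derivative_transform_within_open)
      show "open (cran c)" "cmap c z \<in> cran c" using chart[OF \<open>c \<in> _\<close>] \<open>z \<in> _\<close> by auto
      fix x assume "x \<in> cran c"
      then show "(transition c0 d0 (fst x), transition c1 d1 (fst (snd x)), transition c2 d2 (snd (snd x)))
          = transition c d x"
        unfolding transition_def c(4) d(4) by (subst cinv_prod_chart[OF A c(1-3)]) auto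
    qed
    then show ?thesis by (rule differentiableI)
  qed
  show ?thesis unfolding diff_atlas_def using cover chart trans by blast
qed

text \<open>In product coordinates the projections are linear coordinate projections, hence their
  own derivatives.\<close>

lemma differential_proj:
  fixes A0 :: "('p::topological_space, 'a::euclidean_space) chart set"
    and A1 :: "('q::topological_space, 'b::euclidean_space) chart set"
    and A2 :: "('r::topological_space, 'c::euclidean_space) chart set"
  assumes A: "diff_atlas A0" "diff_atlas A1" "diff_atlas A2"
    and c: "c0 \<in> A0" "c1 \<in> A1" "c2 \<in> A2" and z: "z \<in> cdom (prod_chart c0 c1 c2)"
  defines "P \<equiv> product_atlas A0 A1 A2"
  shows "differential P A0 proj0 z (tvec P (prod_chart c0 c1 c2) z w) = tvec A0 c0 (proj0 z) (fst w)"
    and "differential P A1 proj1 z (tvec P (prod_chart c0 c1 c2) z w) = tvec A1 c1 (proj1 z) (fst (snd w))"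
    and "differential P A2 proj2 z (tvec P (prod_chart c0 c1 c2) z w) = tvec A2 c2 (proj2 z) (snd (snd w))"
proof -
  let ?c = "prod_chart c0 c1 c2"
  have P: "diff_atlas P" and cP: "?c \<in> P"
    unfolding P_def using diff_atlas_product[OF A] c product_atlas_iff by blast+
  note op = diff_atlasD(2)[OF P cP]
  have x: "cmap ?c z \<in> cran ?c" using z by blast
  have z': "proj0 z \<in> cdom c0" "proj1 z \<in> cdom c1" "proj2 z \<in> cdom c2" using z by auto
  have inv: "cmap c0 (proj0 (cinv ?c x)) = fst x" "cmap c1 (proj1 (cinv ?c x)) = fst (snd x)"
    "cmap c2 (proj2 (cinv ?c x)) = snd (snd x)" if "x \<in> cran ?c" for x
    using cinv_prod_chart[OF A c that] that diff_atlasD(4)[OF A(1) c(1)] diff_atlasD(4)[OF A(2) c(2)]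
      diff_atlasD(4)[OF A(3) c(3)] by auto
  show "differential P A0 proj0 z (tvec P ?c z w) = tvec A0 c0 (proj0 z) (fst w)"
    by (rule differential_tvec[where L = fst and F = proj0, OF P A(1) cP z c(1) z'(1)];
        (intro continuous_intros)?; rule has_derivative_transform_within_open[OF _ op x])
      (auto simp del: prod_chart_simps simp: inv intro!: has_derivative_fst has_derivative_ident)
  show "differential P A1 proj1 z (tvec P ?c z w) = tvec A1 c1 (proj1 z) (fst (snd w))"
    by (rule differential_tvec[where L = "\<lambda>w. fst (snd w)" and F = proj1, OF P A(2) cP z c(2) z'(2)];
        (intro continuous_intros)?; rule has_derivative_transform_within_open[OF _ op x])
      (auto simp del: prod_chart_simps simp: inv intro!: has_derivative_fst has_derivative_snd has_derivative_ident)
  show "differential P A2 proj2 z (tvec P ?c z w) = tvec A2 c2 (proj2 z) (snd (snd w))"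
    by (rule differential_tvec[where L = "\<lambda>w. snd (snd w)" and F = proj2, OF P A(3) cP z c(3) z'(3)];
        (intro continuous_intros)?; rule has_derivative_transform_within_open[OF _ op x])
      (auto simp del: prod_chart_simps simp: inv intro!: has_derivative_fst has_derivative_snd has_derivative_ident)
qed

lemma tvec_eq_0_iff:
  assumes "diff_atlas A" "c \<in> A" "p \<in> cdom c"
  shows "tvec A c p u = 0 \<longleftrightarrow> u = 0"
  using tvec_tcoord[OF assms] by (metis linear_0)

text \<open>The three factors become coordinate subspaces throughout a product chart, so a constant
  coordinate field with one nonzero block stays in one distribution.\<close>

lemma tvec_mem_tangent_factor:
  fixes M :: "('p::topological_space \<times> 'q::topological_space \<times> 'r::topological_space,
    'a::euclidean_space \<times> 'b::euclidean_space \<times> 'c::euclidean_space) riem"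
  assumes A: "diff_atlas (atlas M0)" "diff_atlas (atlas M1)" "diff_atlas (atlas M2)"
    and M: "atlas M = product_atlas (atlas M0) (atlas M1) (atlas M2)"
    and c: "c0 \<in> atlas M0" "c1 \<in> atlas M1" "c2 \<in> atlas M2" and z: "z \<in> cdom (prod_chart c0 c1 c2)"
  shows "tvec (atlas M) (prod_chart c0 c1 c2) z (u0, u1, u2) \<in> tangent_factor0 M M1 M2 z \<longleftrightarrow> u1 = 0 \<and> u2 = 0"
    and "tvec (atlas M) (prod_chart c0 c1 c2) z (u0, u1, u2) \<in> tangent_factor1 M M0 M2 z \<longleftrightarrow> u0 = 0 \<and> u2 = 0"
    and "tvec (atlas M) (prod_chart c0 c1 c2) z (u0, u1, u2) \<in> tangent_factor2 M M0 M1 z \<longleftrightarrow> u0 = 0 \<and> u1 = 0"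
  using z tvec_eq_0_iff[OF A(1) c(1)] tvec_eq_0_iff[OF A(2) c(2)] tvec_eq_0_iff[OF A(3) c(3)]
  unfolding tangent_factor0_def tangent_factor1_def tangent_factor2_def
  by (auto simp: M differential_proj[OF A c z])

lemma metric_in_biwarped_product:
  assumes A: "diff_atlas (atlas M0)" "diff_atlas (atlas M1)" "diff_atlas (atlas M2)"
    and c: "c0 \<in> atlas M0" "c1 \<in> atlas M1" "c2 \<in> atlas M2" and x: "x \<in> cran (prod_chart c0 c1 c2)"
  shows "metric_in (biwarped_product M0 f1 M1 f2 M2) (prod_chart c0 c1 c2) x u v =
      metric_in M0 c0 (fst x) (fst u) (fst v)
    + (f1 (cinv c0 (fst x)))\<^sup>2 * metric_in M1 c1 (fst (snd x)) (fst (snd u)) (fst (snd v))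
    + (f2 (cinv c0 (fst x)))\<^sup>2 * metric_in M2 c2 (snd (snd x)) (snd (snd u)) (snd (snd v))"
proof -
  let ?z = "cinv (prod_chart c0 c1 c2) x"
  have z: "?z \<in> cdom (prod_chart c0 c1 c2)" using x by (rule inv_into_into)
  note z' = cinv_prod_chart[OF A c x]
  show ?thesis
    unfolding metric_in_def biwarped_product_def Let_def
    by (simp add: differential_proj[OF A c z] del: prod_chart_simps) (simp add: z' del: prod_chart_simps)
qed


section \<open>Isometric immersions in charts\<close>

lemma inner_form_metric_in:
  assumes "diff_atlas (atlas M)" "c \<in> atlas M" "x \<in> cran c" "inner_form (metric M (cinv c x))"
  shows "inner_form (metric_in M c x)"
proof -
  have q: "cinv c x \<in> cdom c" using assms(3) by (rule inv_into_into)
  note l = tvec_tcoord(3)[OF assms(1,2) q] and b = inner_formD[OF assms(4)]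
  have "bilinear (metric_in M c x)"
    unfolding bilinear_def metric_in_def
    by (intro conjI allI linearI) (simp_all add: linear_add[OF l] linear_cmul[OF l] linear_add[OF b(4)]
      linear_add[OF b(5)] linear_cmul[OF b(4)] linear_cmul[OF b(5)])
  moreover have "metric_in M c x u u > 0" if "u \<noteq> 0" for u
    unfolding metric_in_def using that tvec_eq_0_iff[OF assms(1,2) q] by (intro b(3)) simp
  ultimately show ?thesis using b(2) unfolding inner_form_def metric_in_def by metis
qed

text \<open>The atlas of \<open>M\<close> is only asked to be a \<open>diff_atlas\<close> because it
  will be a product atlas; positivity of the metric of \<open>M\<close> is obtained from
  \<open>N\<close> through the immersion.\<close>

locale immersion_at =
  fixes M :: "('m::topological_space, 'a::euclidean_space) riem"
    and N :: "('n::{t2_space, second_countable_topology}, 'b::euclidean_space) riem"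
    and F :: "'m \<Rightarrow> 'n" and p :: 'm
  assumes atlas_M: "diff_atlas (atlas M)"
    and riem_N: "riemannian_manifold N"
    and immersion: "isometric_immersion M N F"
begin

abbreviation "c \<equiv> chart_at (atlas M) p"
abbreviation "d \<equiv> chart_at (atlas N) (F p)"
abbreviation "x0 \<equiv> cmap c p"
abbreviation "y0 \<equiv> cmap d (F p)"

definition "domain = cmap c ` (cdom c \<inter> F -` cdom d)"
definition "\<phi> x = cmap d (F (cinv c x))"
definition "D\<phi> x v = frechet_derivative \<phi> (at x) v"

text \<open>\<open>hessian u v\<close> is the ambient derivative \<open>\<nabla>\<^sub>u (dF v)\<close> at \<open>p\<close> of the constant coordinate
  field \<open>v\<close>; its tangential part is the Christoffel symbol of \<open>M\<close>, its normal part \<open>h(u, v)\<close>.\<close>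

definition "hessian u v = frechet_derivative (\<lambda>x. D\<phi> x v) (at x0) u
  + christoffel N d y0 (D\<phi> x0 u) (D\<phi> x0 v)"

lemma atlas_N: "diff_atlas (atlas N)" "smooth_atlas (atlas N)"
  using riem_N by (auto simp: riemannian_manifold_def smooth_atlas_diff_atlas)

lemma charts: "c \<in> atlas M" "p \<in> cdom c" "d \<in> atlas N" "F p \<in> cdom d"
  using chart_at[OF atlas_M] chart_at[OF atlas_N(1)] by auto

lemma cinv_c [simp]: "q \<in> cdom c \<Longrightarrow> cinv c (cmap c q) = q"
  using diff_atlasD(4)[OF atlas_M charts(1)] .

lemma cinv_d [simp]: "q \<in> cdom d \<Longrightarrow> cinv d (cmap d q) = q"
  using diff_atlasD(4)[OF atlas_N(1) charts(3)] .

lemma cont_F: "continuous_on UNIV F"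
  using immersion by (simp add: isometric_immersion_def smooth_map_def)

lemma isometry: "metric N (F q) (push M N F q u) (push M N F q v) = metric M q u v"
  using immersion by (simp add: isometric_immersion_def)

lemma domain: "open domain" "x0 \<in> domain" "domain \<subseteq> cran c"
proof -
  have "open (F -` cdom d)" using cont_F diff_atlasD(1)[OF atlas_N(1) charts(3)] by (rule open_vimage[rotated])
  then show "open domain" unfolding domain_def by (rule open_chart_image[OF atlas_M charts(1)])
  show "x0 \<in> domain" "domain \<subseteq> cran c" unfolding domain_def using charts by auto
qed

lemma domainE:
  assumes "x \<in> domain"
  obtains q where "x = cmap c q" "cinv c x = q" "q \<in> cdom c" "F q \<in> cdom d" "\<phi> x = cmap d (F q)" "cinv d (\<phi> x) = F q"
  using assms unfolding domain_def \<phi>_def by auto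

lemma \<phi>_domain: "x \<in> domain \<Longrightarrow> \<phi> x \<in> cran d"
  unfolding domain_def \<phi>_def by auto

lemma \<phi>_x0 [simp]: "\<phi> x0 = y0" unfolding \<phi>_def using charts by simp

lemma smooth_\<phi>: "smooth_on \<phi> domain"
  using immersion charts unfolding isometric_immersion_def smooth_map_def domain_def \<phi>_def[abs_def] by blast

lemma \<phi>_has_derivative: "x \<in> domain \<Longrightarrow> (\<phi> has_derivative D\<phi> x) (at x)"
  unfolding D\<phi>_def[abs_def] using smooth_on_differentiable[OF smooth_\<phi>] frechet_derivative_works by metis

lemma linear_D\<phi>: "x \<in> domain \<Longrightarrow> linear (D\<phi> x)"
  using \<phi>_has_derivative has_derivative_linear by blast

lemma push_tvec:
  assumes "x \<in> domain"
  shows "push M N F (cinv c x) (tvec (atlas M) c (cinv c x) w) = tvec (atlas N) d (F (cinv c x)) (D\<phi> x w)"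
proof -
  obtain q where q: "x = cmap c q" "cinv c x = q" "q \<in> cdom c" "F q \<in> cdom d" using assms domainE by metis
  show ?thesis unfolding q(2)
    by (rule differential_tvec[OF atlas_M atlas_N(1) charts(1) q(3) charts(3) q(4) cont_F])
      (use \<phi>_has_derivative[OF assms] q in \<open>simp add: \<phi>_def[abs_def]\<close>)
qed

text \<open>At \<open>p\<close> and \<open>F p\<close> the charts are the chosen ones, so tangent
  vectors are their own components.\<close>

lemma push_p: "push M N F p = D\<phi> x0"
  using push_tvec[OF domain(2)] charts
  by (simp add: fun_eq_iff tvec_chart_at[OF atlas_M] tvec_chart_at[OF atlas_N(1)])

lemma metric_p: "metric M p = metric_in M c x0" "metric N (F p) = metric_in N d y0"
  using charts
  by (simp_all add: fun_eq_iff metric_in_def tvec_chart_at[OF atlas_M] tvec_chart_at[OF atlas_N(1)])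

lemma inner_form_N: "y \<in> cran d \<Longrightarrow> inner_form (metric_in N d y)"
  using inner_form_metric_in[OF atlas_N(1) charts(3)] riem_N by (auto simp: riemannian_manifold_def)

lemma metric_in_immersion:
  assumes "x \<in> domain"
  shows "metric_in M c x u v = metric_in N d (\<phi> x) (D\<phi> x u) (D\<phi> x v)"
proof -
  obtain q where q: "x = cmap c q" "cinv c x = q" "cinv d (\<phi> x) = F q" using assms domainE by metis
  show ?thesis using push_tvec[OF assms] unfolding metric_in_def q(2,3) by (simp flip: isometry)
qed

lemma inj_D\<phi>:
  assumes "x \<in> domain"
  shows "inj (D\<phi> x)"
proof (rule injI)
  fix w w' assume eq: "D\<phi> x w = D\<phi> x w'"
  obtain q where q: "cinv c x = q" "q \<in> cdom c" using assms domainE by metis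
  have "inj (push M N F q)" using immersion by (simp add: isometric_immersion_def)
  then have "tvec (atlas M) c q w = tvec (atlas M) c q w'"
    using push_tvec[OF assms] eq q by (metis injD)
  then show "w = w'" using tvec_tcoord(2)[OF atlas_M charts(1) q(2)] by metis
qed

lemma metric_N_differentiable: "y \<in> cran d \<Longrightarrow> (\<lambda>y. metric_in N d y u v) differentiable at y"
  using riem_N charts smooth_on_differentiable unfolding riemannian_manifold_def by blast

lemma christoffel_form_N: "christoffel_form N d y0 (christoffel N d y0)"
proof (rule christoffel_form_koszul(1))
  show "open (cran d)" "y0 \<in> cran d" using diff_atlasD(2)[OF atlas_N(1)] charts by auto
  then show "\<And>y. y \<in> cran d \<Longrightarrow> inner_form (metric_in N d y)"
    "\<And>u v. (\<lambda>y. metric_in N d y u v) differentiable at y0"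
    using inner_form_N metric_N_differentiable by blast+
qed

text \<open>The ambient connection, pulled back along \<open>F\<close>, is metric. The Christoffel
  form accounts for the change of the coefficients with fixed arguments, and the bilinear product
  rule adds the change of the arguments.\<close>

lemma metric_compatible:
  assumes a: "(a has_derivative a') (at x0)" and b: "(b has_derivative b') (at x0)"
  shows "((\<lambda>x. metric_in N d (\<phi> x) (a x) (b x)) has_derivative
     (\<lambda>u. metric_in N d y0 (a' u + christoffel N d y0 (D\<phi> x0 u) (a x0)) (b x0)
        + metric_in N d y0 (a x0) (b' u + christoffel N d y0 (D\<phi> x0 u) (b x0)))) (at x0)"
proof -
  have y0: "y0 \<in> cran d" using charts by blast
  have "((\<lambda>y. metric_in N d y v w) has_derivative frechet_derivative (\<lambda>y. metric_in N d y v w) (at y0)) (at (\<phi> x0))" for v w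
    unfolding \<phi>_x0 frechet_derivative_works[symmetric] by (rule metric_N_differentiable[OF y0])
  from has_derivative_compose[OF \<phi>_has_derivative[OF domain(2)] this]
  have D: "((\<lambda>x. metric_in N d (\<phi> x) v w) has_derivative
    (\<lambda>u. metric_in N d y0 (christoffel N d y0 (D\<phi> x0 u) v) w + metric_in N d y0 v (christoffel N d y0 (D\<phi> x0 u) w))) (at x0)" for v w
    using christoffel_form_N by (simp add: christoffel_form_def)
  have bil: "bilinear (metric_in N d (\<phi> x))" if "x \<in> domain" for x
    using inner_formD(1)[OF inner_form_N[OF \<phi>_domain[OF that]]] .
  note l = linear_add[OF inner_formD(4)[OF inner_form_N[OF y0]]] linear_add[OF inner_formD(5)[OF inner_form_N[OF y0]]]
  show ?thesis
    using has_derivative_pairing_bilinear[OF domain(1,2) bil D a b] by (simp add: l add_ac)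
qed

lemma D\<phi>_differentiable: "((\<lambda>x. D\<phi> x v) has_derivative frechet_derivative (\<lambda>x. D\<phi> x v) (at x0)) (at x0)"
  using smooth_on_differentiable[OF smooth_on_frechet_derivative[OF smooth_\<phi>] domain(2)] frechet_derivative_works
  unfolding D\<phi>_def by blast

text \<open>Obtained by differentiating the isometry identity for the constant coordinate fields
  \<open>v\<close> and \<open>w\<close>.\<close>

lemma metric_M_derivative:
  "((\<lambda>x. metric_in M c x v w) has_derivative
     (\<lambda>u. metric_in N d y0 (hessian u v) (D\<phi> x0 w) + metric_in N d y0 (D\<phi> x0 v) (hessian u w))) (at x0)"
  unfolding hessian_def
  by (rule has_derivative_transform_within_open[OF
        metric_compatible[OF D\<phi>_differentiable D\<phi>_differentiable] domain(1,2)])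
    (simp add: metric_in_immersion)

text \<open>Schwarz's theorem handles the second derivative of \<phi>, torsion-freeness the
  Christoffel term.\<close>

lemma hessian_sym: "hessian u v = hessian v u"
proof -
  have "frechet_derivative (\<lambda>x. D\<phi> x v) (at x0) u = frechet_derivative (\<lambda>x. D\<phi> x u) (at x0) v"
    unfolding D\<phi>_def by (rule second_derivative_symmetric[OF smooth_\<phi> domain(1,2)])
  then show ?thesis using christoffel_form_N unfolding hessian_def christoffel_form_def by metis
qed

lemma inner_form_M:
  assumes "x \<in> domain"
  shows "inner_form (metric_in M c x)"
proof -
  note l = linear_D\<phi>[OF assms]
  note b = inner_formD[OF inner_form_N[OF \<phi>_domain[OF assms]]]
  have "bilinear (metric_in M c x)"
    unfolding bilinear_def metric_in_immersion[OF assms]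
    by (intro conjI allI linearI) (simp_all add: linear_add[OF l] linear_cmul[OF l] linear_add[OF b(4)]
      linear_add[OF b(5)] linear_cmul[OF b(4)] linear_cmul[OF b(5)])
  moreover have "D\<phi> x u \<noteq> 0" if "u \<noteq> 0" for u using that inj_D\<phi>[OF assms] l by (metis injD linear_0)
  ultimately show ?thesis using b(2,3) unfolding inner_form_def metric_in_immersion[OF assms] by metis
qed

text \<open>The metric coefficients of \<open>M\<close> are differentiable near enough to apply
  Koszul's formula because \<open>metric_M_derivative\<close> expresses their derivatives at
  \<open>x0\<close> through ambient data.\<close>

lemma
  shows christoffel_form_M: "christoffel_form M c x0 (christoffel M c x0)"
    and koszul_M: "2 * metric_in M c x0 (christoffel M c x0 u v) w =
      frechet_derivative (\<lambda>x. metric_in M c x v w) (at x0) u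
    + frechet_derivative (\<lambda>x. metric_in M c x u w) (at x0) v
    - frechet_derivative (\<lambda>x. metric_in M c x u v) (at x0) w"
proof -
  note * = christoffel_form_koszul[OF domain(1,2) inner_form_M differentiableI[OF metric_M_derivative]]
  show 1: "christoffel_form M c x0 (christoffel M c x0)" by (rule *(1))
  show "2 * metric_in M c x0 (christoffel M c x0 u v) w =
      frechet_derivative (\<lambda>x. metric_in M c x v w) (at x0) u
    + frechet_derivative (\<lambda>x. metric_in M c x u w) (at x0) v
    - frechet_derivative (\<lambda>x. metric_in M c x u v) (at x0) w" by (rule *(2)[OF _ 1])
qed

text \<open>Paired with tangent vectors, \<open>hessian\<close> is symmetric and metric just as the
  Levi-Civita form is, so the alternating sum in Koszul's formula identifies the two.\<close>

lemma gauss: "metric_in N d y0 (hessian u v) (D\<phi> x0 w) = metric_in M c x0 (christoffel M c x0 u v) w"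
proof -
  have y0: "y0 \<in> cran d" using charts by blast
  have "frechet_derivative (\<lambda>x. metric_in M c x v w) (at x0) u =
      metric_in N d y0 (hessian u v) (D\<phi> x0 w) + metric_in N d y0 (D\<phi> x0 v) (hessian u w)" for u v w
    by (rule fun_cong[OF frechet_derivative_at[OF metric_M_derivative], symmetric])
  then show ?thesis
    using koszul_M[of u v w] hessian_sym[of u v] hessian_sym[of w u] hessian_sym[of w v]
      inner_formD(2)[OF inner_form_N[OF y0], of "hessian u w" "D\<phi> x0 v"]
    by simp
qed

text \<open>For any extension of \<open>v\<close> the derivative of its components contributes the
  same tangential term to both sides of the Gauss formula and cancels. The given extension
  \<open>V0\<close> keeps the quantifier in the definite description from being vacuous, so the
  value is unique.\<close>

lemma second_fundamental_form_eq:
  assumes "smooth_field_on (atlas M) W0 V0" "p \<in> W0" "V0 p = v"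
  shows "second_fundamental_form M N F p u v = hessian u v - D\<phi> x0 (christoffel M c x0 u v)"
proof -
  have *: "cov_deriv_along M N F p u (\<lambda>q. push M N F q (V q)) = push M N F p (levi_civita M p u V) +
      (hessian u v - D\<phi> x0 (christoffel M c x0 u v))"
    if V: "smooth_field_on (atlas M) W V" "p \<in> W" "V p = v" for V W
  proof -
    define Vt where "Vt x = tcoord (atlas M) c (cinv c x) (V (cinv c x))" for x
    define Vt' where "Vt' = frechet_derivative Vt (at x0)"
    have "smooth_on Vt (cmap c ` (cdom c \<inter> W))"
      using V charts unfolding smooth_field_on_def Vt_def[abs_def] by blast
    then have Vt': "(Vt has_derivative Vt') (at x0)"
      unfolding Vt'_def frechet_derivative_works[symmetric]
      using charts V by (intro smooth_on_differentiable) auto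
    have v: "Vt x0 = v" using charts V by (simp add: Vt_def tvec_chart_at[OF atlas_M])
    have "((\<lambda>x. D\<phi> x (Vt x)) has_derivative
        (\<lambda>u. frechet_derivative (\<lambda>x. D\<phi> x v) (at x0) u + D\<phi> x0 (Vt' u))) (at x0)"
      using has_derivative_pairing_linear[OF domain(1,2) linear_D\<phi> D\<phi>_differentiable Vt'] by (simp add: v)
    then have "((\<lambda>x. tcoord (atlas N) d (F (cinv c x)) (push M N F (cinv c x) (V (cinv c x)))) has_derivative
        (\<lambda>u. frechet_derivative (\<lambda>x. D\<phi> x v) (at x0) u + D\<phi> x0 (Vt' u))) (at x0)"
    proof (rule has_derivative_transform_within_open[OF _ domain(1,2)])
      fix x assume x: "x \<in> domain"
      then obtain q where q: "cinv c x = q" "q \<in> cdom c" "F q \<in> cdom d" using domainE by metis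
      have "V q = tvec (atlas M) c q (Vt x)"
        using tvec_tcoord(1)[OF atlas_M charts(1) q(2)] by (simp add: Vt_def q)
      then show "D\<phi> x (Vt x) = tcoord (atlas N) d (F (cinv c x)) (push M N F (cinv c x) (V (cinv c x)))"
        using push_tvec[OF x, of "Vt x"] tvec_tcoord(2)[OF atlas_N(1) charts(3) q(3)] by (simp add: q)
    qed
    from fun_cong[OF frechet_derivative_at[OF this], symmetric]
    have "cov_deriv_along M N F p u (\<lambda>q. push M N F q (V q)) = hessian u v + D\<phi> x0 (Vt' u)"
      unfolding cov_deriv_along_def Let_def by (simp add: push_p V hessian_def)
    moreover have "levi_civita M p u V = Vt' u + christoffel M c x0 u v"
      unfolding levi_civita_def cov_deriv_along_def Let_def
      by (simp add: differential_id[OF atlas_M] V Vt'_def Vt_def[abs_def])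
    ultimately show ?thesis by (simp add: push_p linear_add[OF linear_D\<phi>[OF domain(2)]])
  qed
  show ?thesis
    unfolding second_fundamental_form_def
  proof (rule the_equality)
    show "\<forall>W V. smooth_field_on (atlas M) W V \<longrightarrow> p \<in> W \<longrightarrow> V p = v \<longrightarrow>
      cov_deriv_along M N F p u (\<lambda>q. push M N F q (V q)) = push M N F p (levi_civita M p u V) +
        (hessian u v - D\<phi> x0 (christoffel M c x0 u v))"
      using * by blast
    fix h assume "\<forall>W V. smooth_field_on (atlas M) W V \<longrightarrow> p \<in> W \<longrightarrow> V p = v \<longrightarrow>
      cov_deriv_along M N F p u (\<lambda>q. push M N F q (V q)) = push M N F p (levi_civita M p u V) + h"
    then have "push M N F p (levi_civita M p u V0) + h
        = push M N F p (levi_civita M p u V0) + (hessian u v - D\<phi> x0 (christoffel M c x0 u v))"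
      using *[OF assms] assms by simp
    then show "h = hessian u v - D\<phi> x0 (christoffel M c x0 u v)" by simp
  qed
qed

end

section \<open>Immersions into a Kaehler manifold\<close>

locale kaehler_immersion_at = immersion_at M N F p
  for M :: "('m::topological_space, 'a::euclidean_space) riem"
    and N :: "('n::{t2_space, second_countable_topology}, 'b::euclidean_space) riem"
    and F :: "'m \<Rightarrow> 'n" and p :: 'm +
  fixes J :: "'n \<Rightarrow> 'b \<Rightarrow> 'b"
  assumes kaehler: "kaehler_manifold N J"
begin

text \<open>\<open>J\<close> in the components of the chart \<open>d\<close>, a form in which it can
  be differentiated with respect to the base point.\<close>

definition "Jc y w = tcoord (atlas N) d (cinv d y) (J (cinv d y) (tvec (atlas N) d (cinv d y) w))"

lemma J: "linear (J q)" "J q (J q w) = - w" "metric N q (J q v) (J q w) = metric N q v w"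
  using kaehler by (auto simp: kaehler_manifold_def)

text \<open>An orthogonal map with square minus the identity is skew.\<close>

lemma metric_J: "metric N q (J q v) w = - metric N q v (J q w)"
proof -
  have i: "inner_form (metric N q)" using riem_N by (simp add: riemannian_manifold_def)
  have "metric N q (J q v) w = metric N q (J q (J q v)) (J q w)" by (simp add: J(3))
  then show ?thesis using linear_neg[OF inner_formD(5)[OF i, of "J q w"], of v] by (simp add: J(2))
qed

lemma metric_J_self: "metric N q v (J q v) = 0"
proof -
  have i: "inner_form (metric N q)" using riem_N by (simp add: riemannian_manifold_def)
  show ?thesis using metric_J[of q v v] inner_formD(2)[OF i, of v "J q v"] by simp
qed

lemma Jc_p: "Jc y0 = J (F p)"
  using charts by (simp add: fun_eq_iff Jc_def tvec_chart_at[OF atlas_N(1)])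

lemma linear_Jc: "y \<in> cran d \<Longrightarrow> linear (Jc y)"
proof -
  assume "y \<in> cran d"
  then have q: "cinv d y \<in> cdom d" by (rule inv_into_into)
  note l = tvec_tcoord(3,4)[OF atlas_N(1) charts(3) q] J(1)
  show "linear (Jc y)" unfolding Jc_def
    by (rule linearI) (simp_all add: linear_add[OF l(1)] linear_add[OF l(2)] linear_add[OF l(3)]
        linear_cmul[OF l(1)] linear_cmul[OF l(2)] linear_cmul[OF l(3)])
qed

text \<open>The condition that \<open>J\<close> is parallel is tested on the field with constant
  components \<open>w\<close>. Its own covariant derivative is a pure Christoffel term, so the
  derivative of \<open>Jc\<close> is the commutator of \<open>J\<close> with that term.\<close>

lemma Jc_has_derivative:
  "((\<lambda>y. Jc y w) has_derivative (\<lambda>u. J (F p) (christoffel N d y0 u w) - christoffel N d y0 u (J (F p) w))) (at y0)"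
proof -
  have "smooth_on (\<lambda>y. Jc y w) (cran d)"
    using kaehler charts unfolding kaehler_manifold_def Jc_def by blast
  then have D: "((\<lambda>y. Jc y w) has_derivative frechet_derivative (\<lambda>y. Jc y w) (at y0)) (at y0)"
    unfolding frechet_derivative_works[symmetric] using charts by (intro smooth_on_differentiable) auto
  have "frechet_derivative (\<lambda>y. Jc y w) (at y0) =
      (\<lambda>u. J (F p) (christoffel N d y0 u w) - christoffel N d y0 u (J (F p) w))"
  proof
    fix u
    let ?V = "\<lambda>q. tvec (atlas N) d q w"
    have "((\<lambda>y. tcoord (atlas N) d (cinv d y) (?V (cinv d y))) has_derivative (\<lambda>u. 0)) (at y0)"
    proof (rule has_derivative_transform_within_open[OF has_derivative_const diff_atlasD(2)[OF atlas_N(1) charts(3)]])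
      show "y0 \<in> cran d" using charts by blast
      show "\<And>y. y \<in> cran d \<Longrightarrow> w = tcoord (atlas N) d (cinv d y) (?V (cinv d y))"
        using tvec_tcoord(2)[OF atlas_N(1) charts(3)] by auto
    qed
    from fun_cong[OF frechet_derivative_at[OF this], symmetric]
    have "levi_civita N (F p) u ?V = christoffel N d y0 u w"
      unfolding levi_civita_def cov_deriv_along_def Let_def
      by (simp add: differential_id[OF atlas_N(1)] tvec_chart_at[OF atlas_N(1)])
    moreover have "levi_civita N (F p) u (\<lambda>q. J q (?V q)) = frechet_derivative (\<lambda>y. Jc y w) (at y0) u
        + christoffel N d y0 u (J (F p) w)"
      unfolding levi_civita_def cov_deriv_along_def Let_def
      by (simp add: differential_id[OF atlas_N(1)] tvec_chart_at[OF atlas_N(1)] Jc_def)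
    moreover have "levi_civita N (F p) u (\<lambda>q. J q (?V q)) = J (F p) (levi_civita N (F p) u ?V)"
      using kaehler constant_field_smooth[OF atlas_N(2) charts(3)] charts(4)
      unfolding kaehler_manifold_def by blast
    ultimately show "frechet_derivative (\<lambda>y. Jc y w) (at y0) u
        = J (F p) (christoffel N d y0 u w) - christoffel N d y0 u (J (F p) w)"
      by (simp add: eq_diff_eq)
  qed
  with D show ?thesis by simp
qed

text \<open>The orthogonality of \<open>JX\<close> and \<open>W\<close> is differentiated along
  \<open>U\<close>. Skewness then moves \<open>J\<close> to the other argument, and since
  \<open>JX\<close> equals the tangent vector \<open>Y\<close> at \<open>p\<close>,
  \<open>gauss\<close> replaces the ambient derivative of \<open>W\<close> by the intrinsic
  one.\<close>

lemma hessian_J: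
  assumes S: "open S" "x0 \<in> S" "S \<subseteq> domain"
    and orth: "\<And>x. x \<in> S \<Longrightarrow> metric_in N d (\<phi> x) (Jc (\<phi> x) (D\<phi> x X)) (D\<phi> x W) = 0"
    and Y: "J (F p) (D\<phi> x0 X) = D\<phi> x0 Y"
  shows "metric N (F p) (hessian U X) (J (F p) (D\<phi> x0 W)) = metric M p (christoffel M c x0 U W) Y"
proof -
  let ?\<Gamma> = "christoffel N d y0"
  have y0: "y0 \<in> cran d" using charts by blast
  have i: "inner_form (metric N (F p))" using riem_N by (simp add: riemannian_manifold_def)
  have lJ: "linear (Jc (\<phi> x))" if "x \<in> domain" for x using linear_Jc[OF \<phi>_domain[OF that]] .
  let ?b = "\<lambda>x. D\<phi> x W" and ?a = "\<lambda>x. Jc (\<phi> x) (D\<phi> x X)"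
  let ?X' = "frechet_derivative (\<lambda>x. D\<phi> x X) (at x0)"
  have D: "((\<lambda>x. Jc (\<phi> x) w) has_derivative
      (\<lambda>u. J (F p) (?\<Gamma> (D\<phi> x0 u) w) - ?\<Gamma> (D\<phi> x0 u) (J (F p) w))) (at x0)" for w
    by (rule has_derivative_compose[OF \<phi>_has_derivative[OF domain(2)]]) (simp add: Jc_has_derivative)
  have a: "(?a has_derivative (\<lambda>u. J (F p) (?\<Gamma> (D\<phi> x0 u) (D\<phi> x0 X)) - ?\<Gamma> (D\<phi> x0 u) (J (F p) (D\<phi> x0 X))
      + J (F p) (?X' u))) (at x0)"
    using has_derivative_pairing_linear[OF domain(1,2) lJ D D\<phi>_differentiable] by (simp add: Jc_p)
  note mc = metric_compatible[OF a D\<phi>_differentiable[of W]]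
  have "((\<lambda>x. metric_in N d (\<phi> x) (?a x) (?b x)) has_derivative (\<lambda>u. 0)) (at x0)"
    by (rule has_derivative_transform_within_open[OF has_derivative_const S(1,2)]) (simp add: orth)
  \<comment> \<open>The Christoffel term added by \<open>metric_compatible\<close> cancels the one
    subtracted in \<open>a\<close>, which leaves \<open>J (F p) (hessian U X)\<close>.\<close>
  from fun_cong[OF has_derivative_unique[OF mc this], of U]
  have "metric N (F p) (J (F p) (hessian U X)) (D\<phi> x0 W) + metric N (F p) (J (F p) (D\<phi> x0 X)) (hessian U W) = 0"
    by (simp add: metric_p hessian_def Jc_p linear_add[OF J(1)] add_ac)
  then have "metric N (F p) (hessian U X) (J (F p) (D\<phi> x0 W)) = metric N (F p) (hessian U W) (D\<phi> x0 Y)"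
    using inner_formD(2)[OF i, of "D\<phi> x0 Y" "hessian U W"] by (simp add: metric_J Y)
  then show ?thesis using gauss[of U W Y] by (simp add: metric_p)
qed

end


section \<open>Biwarped products in Kaehler manifolds\<close>

lemma (in kaehler_immersion_at) metric_Jc:
  assumes x: "x \<in> domain"
  shows "metric_in N d (\<phi> x) (Jc (\<phi> x) (D\<phi> x X)) (D\<phi> x W) =
    metric N (F (cinv c x)) (J (F (cinv c x)) (push M N F (cinv c x) (tvec (atlas M) c (cinv c x) X)))
      (push M N F (cinv c x) (tvec (atlas M) c (cinv c x) W))"
proof -
  obtain q where q: "cinv c x = q" "F q \<in> cdom d" "cinv d (\<phi> x) = F q" using x domainE by metis
  show ?thesis
    using push_tvec[OF x] tvec_tcoord(1)[OF atlas_N(1) charts(3) q(2)]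
    unfolding metric_in_def Jc_def q by simp
qed

section \<open>The biwarped product and its product charts\<close>

locale biwarped_kaehler_immersion =
  fixes N :: "('n::{t2_space, second_countable_topology}, 'e::euclidean_space) riem"
    and J :: "'n \<Rightarrow> 'e \<Rightarrow> 'e"
    and MT :: "('p::{t2_space, second_countable_topology}, 'a::euclidean_space) riem"
    and MR :: "('q::{t2_space, second_countable_topology}, 'b::euclidean_space) riem"
    and MS :: "('r::{t2_space, second_countable_topology}, 'c::euclidean_space) riem"
    and f \<sigma> :: "'p \<Rightarrow> real"
    and M :: "('p \<times> 'q \<times> 'r, 'a \<times> 'b \<times> 'c) riem"
    and F :: "'p \<times> 'q \<times> 'r \<Rightarrow> 'n"
    and DT DR DS :: "'p \<times> 'q \<times> 'r \<Rightarrow> ('a \<times> 'b \<times> 'c) set"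
    and \<theta> :: "'p \<times> 'q \<times> 'r \<Rightarrow> real"
  assumes N: "kaehler_manifold N J"
    and MT: "riemannian_manifold MT" and MR: "riemannian_manifold MR" and MS: "riemannian_manifold MS"
    and f: "smooth_function (atlas MT) f" "\<forall>x. 0 < f x"
    and \<sigma>: "smooth_function (atlas MT) \<sigma>" "\<forall>x. 0 < \<sigma> x"
    and M: "M = biwarped_product MT f MR \<sigma> MS"
    and DT: "DT = tangent_factor0 M MR MS"
    and DR: "DR = tangent_factor1 M MT MS"
    and DS: "DS = tangent_factor2 M MT MR"
    and J_induced: "gen_J_induced_order1 M N J F DT DR DS \<theta>"
begin

lemma atlases: "diff_atlas (atlas MT)" "diff_atlas (atlas MR)" "diff_atlas (atlas MS)"
  using MT MR MS by (auto simp: riemannian_manifold_def smooth_atlas_diff_atlas)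

lemma atlas_M: "atlas M = product_atlas (atlas MT) (atlas MR) (atlas MS)"
  by (simp add: M biwarped_product_def Let_def)

lemma diff_atlas_M: "diff_atlas (atlas M)"
  unfolding atlas_M by (rule diff_atlas_product[OF atlases])

lemma holomorphic:
  assumes "u \<in> DT q"
  obtains u' where "u' \<in> DT q" "J (F q) (push M N F q u) = push M N F q u'"
proof -
  have "holomorphic_distribution M N J F DT"
    using J_induced unfolding gen_J_induced_order1_def by (elim conjE)
  then have "J (F q) ` push M N F q ` DT q \<subseteq> push M N F q ` DT q"
    unfolding holomorphic_distribution_def by (rule spec)
  moreover have "J (F q) (push M N F q u) \<in> J (F q) ` push M N F q ` DT q" using assms by (intro imageI)
  ultimately have "J (F q) (push M N F q u) \<in> push M N F q ` DT q" by (rule subsetD)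
  then show thesis using that by (elim imageE)
qed

lemma kaehler_immersion_at: "kaehler_immersion_at M N F J"
  using N J_induced diff_atlas_M
  by unfold_locales (auto simp: kaehler_manifold_def gen_J_induced_order1_def)

end

text \<open>The chosen chart at \<open>p\<close> belongs to the product atlas; naming its factors
  splits the coordinates at \<open>p\<close> into a base block and two fibre blocks.\<close>

locale biwarped_chart = biwarped_kaehler_immersion N J MT MR MS f \<sigma> M F DT DR DS \<theta>
  for N :: "('n::{t2_space, second_countable_topology}, 'e::euclidean_space) riem"
    and J :: "'n \<Rightarrow> 'e \<Rightarrow> 'e"
    and MT :: "('p::{t2_space, second_countable_topology}, 'a::euclidean_space) riem"
    and MR :: "('q::{t2_space, second_countable_topology}, 'b::euclidean_space) riem"
    and MS :: "('r::{t2_space, second_countable_topology}, 'c::euclidean_space) riem"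
    and f \<sigma> :: "'p \<Rightarrow> real"
    and M :: "('p \<times> 'q \<times> 'r, 'a \<times> 'b \<times> 'c) riem"
    and F :: "'p \<times> 'q \<times> 'r \<Rightarrow> 'n"
    and DT DR DS :: "'p \<times> 'q \<times> 'r \<Rightarrow> ('a \<times> 'b \<times> 'c) set"
    and \<theta> :: "'p \<times> 'q \<times> 'r \<Rightarrow> real" +
  fixes p c0 c1 c2
  assumes chart_at_p: "chart_at (atlas M) p = prod_chart c0 c1 c2"
    and c0: "c0 \<in> atlas MT" and c1: "c1 \<in> atlas MR" and c2: "c2 \<in> atlas MS"
begin

sublocale I: kaehler_immersion_at M N F p J
  by (rule kaehler_immersion_at)

abbreviation "z0 \<equiv> cmap c0 (proj0 p)"
abbreviation "z1 \<equiv> cmap c1 (proj1 p)"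
abbreviation "z2 \<equiv> cmap c2 (proj2 p)"
abbreviation "g1 \<equiv> metric_in MR c1 z1"
abbreviation "g2 \<equiv> metric_in MS c2 z2"
abbreviation "f' \<equiv> frechet_derivative (\<lambda>x. f (cinv c0 x)) (at z0)"
abbreviation "\<sigma>' \<equiv> frechet_derivative (\<lambda>x. \<sigma> (cinv c0 x)) (at z0)"
abbreviation "a \<equiv> f (proj0 p)"
abbreviation "b \<equiv> \<sigma> (proj0 p)"
abbreviation "G \<equiv> metric_in M I.c I.x0"
abbreviation "\<Gamma> \<equiv> christoffel M I.c I.x0"

lemma p_mem: "proj0 p \<in> cdom c0" "proj1 p \<in> cdom c1" "proj2 p \<in> cdom c2"
  using I.charts(2) unfolding chart_at_p by auto

lemma x0: "I.x0 = (z0, z1, z2)" unfolding chart_at_p by simp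

lemma cinv_c0 [simp]: "cinv c0 z0 = proj0 p"
  using diff_atlasD(4)[OF atlases(1) c0 p_mem(1)] .

lemma tvec_mem:
  assumes "x \<in> cran I.c"
  shows "tvec (atlas M) I.c (cinv I.c x) (u0, u1, u2) \<in> DT (cinv I.c x) \<longleftrightarrow> u1 = 0 \<and> u2 = 0"
    "tvec (atlas M) I.c (cinv I.c x) (u0, u1, u2) \<in> DR (cinv I.c x) \<longleftrightarrow> u0 = 0 \<and> u2 = 0"
    "tvec (atlas M) I.c (cinv I.c x) (u0, u1, u2) \<in> DS (cinv I.c x) \<longleftrightarrow> u0 = 0 \<and> u1 = 0"
proof -
  have z: "cinv I.c x \<in> cdom (prod_chart c0 c1 c2)"
    using inv_into_into[OF assms] unfolding chart_at_p .
  show "tvec (atlas M) I.c (cinv I.c x) (u0, u1, u2) \<in> DT (cinv I.c x) \<longleftrightarrow> u1 = 0 \<and> u2 = 0"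
    "tvec (atlas M) I.c (cinv I.c x) (u0, u1, u2) \<in> DR (cinv I.c x) \<longleftrightarrow> u0 = 0 \<and> u2 = 0"
    "tvec (atlas M) I.c (cinv I.c x) (u0, u1, u2) \<in> DS (cinv I.c x) \<longleftrightarrow> u0 = 0 \<and> u1 = 0"
    using tvec_mem_tangent_factor[OF atlases atlas_M c0 c1 c2 z] unfolding DT DR DS chart_at_p by simp_all
qed

lemma mem_p:
  "(u0, u1, u2) \<in> DT p \<longleftrightarrow> u1 = 0 \<and> u2 = 0"
  "(u0, u1, u2) \<in> DR p \<longleftrightarrow> u0 = 0 \<and> u2 = 0"
  "(u0, u1, u2) \<in> DS p \<longleftrightarrow> u0 = 0 \<and> u1 = 0"
  using tvec_mem[of I.x0] I.charts(2) by (simp_all add: tvec_chart_at[OF diff_atlas_M])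

section \<open>Metric and Christoffel symbols of the biwarped product\<close>

lemma warp_derivative:
  "((\<lambda>x. f (cinv c0 x)) has_derivative f') (at z0)" "((\<lambda>x. \<sigma> (cinv c0 x)) has_derivative \<sigma>') (at z0)"
  using f(1) \<sigma>(1) c0 p_mem smooth_on_differentiable
  unfolding frechet_derivative_works[symmetric] smooth_function_def by blast+

text \<open>The clauses with a zero argument make the missing blocks drop out when Koszul's formula
  is evaluated on fields tangent to a single factor.\<close>

lemma factor_metric:
  assumes "riemannian_manifold X" "e \<in> atlas X" "q \<in> cdom e"
  shows "inner_form (metric_in X e (cmap e q))"
    "((\<lambda>y. metric_in X e y u v) has_derivative frechet_derivative (\<lambda>y. metric_in X e y u v) (at (cmap e q)))
      (at (cmap e q))"
    "frechet_derivative (\<lambda>y. metric_in X e y 0 v) (at (cmap e q)) = (\<lambda>u. 0)"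
    "frechet_derivative (\<lambda>y. metric_in X e y u 0) (at (cmap e q)) = (\<lambda>u. 0)"
proof -
  have A: "diff_atlas (atlas X)" using assms(1) by (auto simp: riemannian_manifold_def smooth_atlas_diff_atlas)
  have ip: "inner_form (metric_in X e y)" if "y \<in> cran e" for y
    using inner_form_metric_in[OF A assms(2) that] assms(1) by (simp add: riemannian_manifold_def)
  show "inner_form (metric_in X e (cmap e q))" using ip assms by blast
  show "((\<lambda>y. metric_in X e y u v) has_derivative frechet_derivative (\<lambda>y. metric_in X e y u v) (at (cmap e q)))
      (at (cmap e q))"
    unfolding frechet_derivative_works[symmetric]
    using assms smooth_on_differentiable unfolding riemannian_manifold_def by blast
  have mem: "cmap e q \<in> cran e" using assms by blast
  have "((\<lambda>y. metric_in X e y 0 v) has_derivative (\<lambda>u. 0)) (at (cmap e q))"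
    by (rule has_derivative_transform_within_open[OF has_derivative_const diff_atlasD(2)[OF A assms(2)] mem])
      (use linear_0[OF inner_formD(5)[OF ip]] in simp)
  then show "frechet_derivative (\<lambda>y. metric_in X e y 0 v) (at (cmap e q)) = (\<lambda>u. 0)"
    by (rule frechet_derivative_at[symmetric])
  have "((\<lambda>y. metric_in X e y u 0) has_derivative (\<lambda>u. 0)) (at (cmap e q))"
    by (rule has_derivative_transform_within_open[OF has_derivative_const diff_atlasD(2)[OF A assms(2)] mem])
      (use linear_0[OF inner_formD(4)[OF ip]] in simp)
  then show "frechet_derivative (\<lambda>y. metric_in X e y u 0) (at (cmap e q)) = (\<lambda>u. 0)"
    by (rule frechet_derivative_at[symmetric])
qed

lemmas g0_facts = factor_metric[OF MT c0 p_mem(1)]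
lemmas g1_facts = factor_metric[OF MR c1 p_mem(2)]
lemmas g2_facts = factor_metric[OF MS c2 p_mem(3)]

lemma metric_in_M:
  "x \<in> cran I.c \<Longrightarrow> metric_in M I.c x u v =
      metric_in MT c0 (fst x) (fst u) (fst v)
    + (f (cinv c0 (fst x)))\<^sup>2 * metric_in MR c1 (fst (snd x)) (fst (snd u)) (fst (snd v))
    + (\<sigma> (cinv c0 (fst x)))\<^sup>2 * metric_in MS c2 (snd (snd x)) (snd (snd u)) (snd (snd v))"
  using metric_in_biwarped_product[OF atlases c0 c1 c2, of x f \<sigma> u v]
  unfolding M[symmetric] chart_at_p by blast

lemma x0_mem: "I.x0 \<in> cran I.c"
  using I.charts by blast

lemma G_eq: "G (u0, u1, u2) (v0, v1, v2) = metric_in MT c0 z0 u0 v0 + a\<^sup>2 * g1 u1 v1 + b\<^sup>2 * g2 u2 v2"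
  using metric_in_M[OF x0_mem] unfolding x0 by simp

lemma G_derivative:
  "frechet_derivative (\<lambda>x. metric_in M I.c x (u0, u1, u2) (v0, v1, v2)) (at I.x0) (w0, w1, w2) =
     frechet_derivative (\<lambda>y. metric_in MT c0 y u0 v0) (at z0) w0
   + 2 * a * f' w0 * g1 u1 v1 + a\<^sup>2 * frechet_derivative (\<lambda>y. metric_in MR c1 y u1 v1) (at z1) w1
   + 2 * b * \<sigma>' w0 * g2 u2 v2 + b\<^sup>2 * frechet_derivative (\<lambda>y. metric_in MS c2 y u2 v2) (at z2) w2"
proof -
  have D: "((\<lambda>x. metric_in MT c0 (fst x) u0 v0) has_derivative
      (\<lambda>w. frechet_derivative (\<lambda>y. metric_in MT c0 y u0 v0) (at z0) (fst w))) (at I.x0)"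
    "((\<lambda>x. f (cinv c0 (fst x))) has_derivative (\<lambda>w. f' (fst w))) (at I.x0)"
    "((\<lambda>x. \<sigma> (cinv c0 (fst x))) has_derivative (\<lambda>w. \<sigma>' (fst w))) (at I.x0)"
    "((\<lambda>x. metric_in MR c1 (fst (snd x)) u1 v1) has_derivative
      (\<lambda>w. frechet_derivative (\<lambda>y. metric_in MR c1 y u1 v1) (at z1) (fst (snd w)))) (at I.x0)"
    "((\<lambda>x. metric_in MS c2 (snd (snd x)) u2 v2) has_derivative
      (\<lambda>w. frechet_derivative (\<lambda>y. metric_in MS c2 y u2 v2) (at z2) (snd (snd w)))) (at I.x0)"
    unfolding x0
    by (rule has_derivative_compose[where f = fst], rule has_derivative_fst, rule has_derivative_ident,
        simp add: g0_facts(2) warp_derivative)+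
      (rule has_derivative_compose[where f = "\<lambda>x. fst (snd x)"], rule has_derivative_fst, rule has_derivative_snd,
        rule has_derivative_ident, simp add: g1_facts(2),
       rule has_derivative_compose[where f = "\<lambda>x. snd (snd x)"], rule has_derivative_snd, rule has_derivative_snd,
        rule has_derivative_ident, simp add: g2_facts(2))
  let ?D = "\<lambda>w. frechet_derivative (\<lambda>y. metric_in MT c0 y u0 v0) (at z0) (fst w)
   + 2 * a * f' (fst w) * g1 u1 v1 + a\<^sup>2 * frechet_derivative (\<lambda>y. metric_in MR c1 y u1 v1) (at z1) (fst (snd w))
   + 2 * b * \<sigma>' (fst w) * g2 u2 v2 + b\<^sup>2 * frechet_derivative (\<lambda>y. metric_in MS c2 y u2 v2) (at z2) (snd (snd w))"
  have "((\<lambda>x. metric_in MT c0 (fst x) u0 v0 + (f (cinv c0 (fst x)))\<^sup>2 * metric_in MR c1 (fst (snd x)) u1 v1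
     + (\<sigma> (cinv c0 (fst x)))\<^sup>2 * metric_in MS c2 (snd (snd x)) u2 v2) has_derivative ?D) (at I.x0)"
    by (rule has_derivative_eq_rhs, (rule has_derivative_add has_derivative_mult has_derivative_power D)+)
      (simp add: x0 fun_eq_iff algebra_simps)
  then have "((\<lambda>x. metric_in M I.c x (u0, u1, u2) (v0, v1, v2)) has_derivative ?D) (at I.x0)"
    by (rule has_derivative_transform_within_open[OF _ diff_atlasD(2)[OF diff_atlas_M I.charts(1)] x0_mem])
      (simp add: metric_in_M)
  from fun_cong[OF frechet_derivative_at[OF this], of "(w0, w1, w2)"] show ?thesis by simp
qed

lemmas derivative_zero =
  linear_0[OF has_derivative_linear[OF g0_facts(2)]] linear_0[OF has_derivative_linear[OF g1_facts(2)]]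
  linear_0[OF has_derivative_linear[OF g2_facts(2)]]
  linear_0[OF has_derivative_linear[OF warp_derivative(1)]] linear_0[OF has_derivative_linear[OF warp_derivative(2)]]
  g0_facts(3,4) g1_facts(3,4) g2_facts(3,4)
  linear_0[OF inner_formD(4)[OF g1_facts(1)]] linear_0[OF inner_formD(5)[OF g1_facts(1)]]
  linear_0[OF inner_formD(4)[OF g2_facts(1)]] linear_0[OF inner_formD(5)[OF g2_facts(1)]]

text \<open>The first two terms of Koszul's formula differentiate base-fibre coefficients, which
  vanish. Only the derivative of the warped fibre metrics along \<open>y\<close> is left, with a
  minus sign.\<close>

lemma \<Gamma>_fibre_fibre:
  "G (\<Gamma> (0, u1, u2) (0, w1, w2)) (y, 0, 0) = - (a * f' y * g1 u1 w1 + b * \<sigma>' y * g2 u2 w2)"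
  using I.koszul_M[of "(0, u1, u2)" "(0, w1, w2)" "(y, 0, 0)"] by (simp add: G_derivative derivative_zero)

text \<open>Here the term differentiating along \<open>y\<close> survives: the base metric does not
  change in fibre directions, and the base-fibre coefficients vanish.\<close>

lemma \<Gamma>_base_fibre:
  "G (\<Gamma> (y, 0, 0) (0, u1, u2)) (w0, w1, w2) = a * f' y * g1 u1 w1 + b * \<sigma>' y * g2 u2 w2"
  using I.koszul_M[of "(y, 0, 0)" "(0, u1, u2)" "(w0, w1, w2)"] by (simp add: G_derivative derivative_zero)

lemma G_inner: "inner_form G"
  by (rule I.inner_form_M[OF I.domain(2)])

lemma warp_pos: "a > 0" "b > 0"
  using f(2) \<sigma>(2) by auto

text \<open>The rule that the derivative of a fibre field along the base is the logarithmic
  derivative of the warping function times that field. The two fibres have different factors, so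
  each is treated by itself to obtain a multiple of the given vector.\<close>

lemma \<Gamma>_base_fibre1: "\<Gamma> (y, 0, 0) (0, u, 0) = (f' y / a) *\<^sub>R (0, u, 0)"
proof (rule inner_form_ext[OF G_inner])
  fix w :: "'a \<times> 'b \<times> 'c"
  obtain w0 w1 w2 where w: "w = (w0, w1, w2)" by (cases w) auto
  show "G (\<Gamma> (y, 0, 0) (0, u, 0)) w = G ((f' y / a) *\<^sub>R (0, u, 0)) w"
    using warp_pos linear_0[OF inner_formD(5)[OF g0_facts(1)]]
    unfolding w \<Gamma>_base_fibre linear_cmul[OF inner_formD(5)[OF G_inner]] G_eq
    by (simp add: derivative_zero field_simps power2_eq_square)
qed

lemma \<Gamma>_base_fibre2: "\<Gamma> (y, 0, 0) (0, 0, u) = (\<sigma>' y / b) *\<^sub>R (0, 0, u)"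
proof (rule inner_form_ext[OF G_inner])
  fix w :: "'a \<times> 'b \<times> 'c"
  obtain w0 w1 w2 where w: "w = (w0, w1, w2)" by (cases w) auto
  show "G (\<Gamma> (y, 0, 0) (0, 0, u)) w = G ((\<sigma>' y / b) *\<^sub>R (0, 0, u)) w"
    using warp_pos linear_0[OF inner_formD(5)[OF g0_facts(1)]]
    unfolding w \<Gamma>_base_fibre linear_cmul[OF inner_formD(5)[OF G_inner]] G_eq
    by (simp add: derivative_zero field_simps power2_eq_square)
qed

section \<open>Mixed second fundamental form and derivatives of the warping functions\<close>

lemma J_base: "\<exists>y. J (F p) (I.D\<phi> I.x0 (v, 0, 0)) = I.D\<phi> I.x0 (y, 0, 0)"
proof -
  have "(v, 0, 0) \<in> DT p" by (simp add: mem_p)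
  then obtain u where "u \<in> DT p" "J (F p) (push M N F p (v, 0, 0)) = push M N F p u"
    by (rule holomorphic)
  then show ?thesis using mem_p(1) unfolding I.push_p by (cases u) auto
qed

text \<open>An instance of \<open>hessian_J\<close> with a base field and a fibre field, evaluated
  by \<open>\<Gamma>_fibre_fibre\<close>; \<open>hessian_sym\<close> exchanges the direction of
  differentiation with the field.\<close>

lemma hessian_fibre_base:
  assumes Y: "J (F p) (I.D\<phi> I.x0 (v, 0, 0)) = I.D\<phi> I.x0 (y, 0, 0)"
  shows "metric N (F p) (I.hessian (v, 0, 0) (0, u1, u2)) (J (F p) (I.D\<phi> I.x0 (0, w1, w2)))
    = - (a * f' y * g1 u1 w1 + b * \<sigma>' y * g2 u2 w2)"
proof -
  have orth: "metric_in N I.d (I.\<phi> x) (I.Jc (I.\<phi> x) (I.D\<phi> x (v, 0, 0))) (I.D\<phi> x (0, w1, w2)) = 0"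
    if x: "x \<in> I.domain" for x
  proof -
    let ?q = "cinv I.c x" and ?t = "tvec (atlas M) I.c (cinv I.c x)"
    have xc: "x \<in> cran I.c" using x I.domain by blast
    have "?t (v, 0, 0) \<in> DT ?q" using tvec_mem(1)[OF xc] by simp
    then obtain u where u: "u \<in> DT ?q" "J (F ?q) (push M N F ?q (?t (v, 0, 0))) = push M N F ?q u"
      by (rule holomorphic)
    \<comment> \<open>\<open>DT\<close> is known to be orthogonal to \<open>DR\<close> and to
      \<open>DS\<close> separately, so the fibre field is split into its two blocks.\<close>
    have "?t (0, w1, 0) \<in> DR ?q" "?t (0, 0, w2) \<in> DS ?q" using tvec_mem[OF xc] by simp_all
    then have "metric M ?q u (?t (0, w1, 0)) = 0" "metric M ?q u (?t (0, 0, w2)) = 0"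
      using u(1) J_induced unfolding gen_J_induced_order1_def by blast+
    then have "metric_in N I.d (I.\<phi> x) (I.Jc (I.\<phi> x) (I.D\<phi> x (v, 0, 0))) (I.D\<phi> x (0, w1, 0)) = 0"
      "metric_in N I.d (I.\<phi> x) (I.Jc (I.\<phi> x) (I.D\<phi> x (v, 0, 0))) (I.D\<phi> x (0, 0, w2)) = 0"
      unfolding I.metric_Jc[OF x] u(2) I.isometry by simp_all
    moreover have "I.D\<phi> x (0, w1, w2) = I.D\<phi> x (0, w1, 0) + I.D\<phi> x (0, 0, w2)"
      using linear_add[OF I.linear_D\<phi>[OF x], of "(0, w1, 0)" "(0, 0, w2)"] by simp
    ultimately show ?thesis
      by (simp add: linear_add[OF inner_formD(4)[OF I.inner_form_N[OF I.\<phi>_domain[OF x]]]])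
  qed
  from I.hessian_J[OF I.domain(1,2) subset_refl orth Y, of "(0, u1, u2)"] show ?thesis
    by (simp add: \<Gamma>_fibre_fibre I.metric_p I.hessian_sym[of "(v, 0, 0)"])
qed

text \<open>Since \<open>J\<close> squares to minus the identity, the preimage is the negative of
  the image.\<close>

lemma J_base_surj:
  obtains v where "J (F p) (I.D\<phi> I.x0 (v, 0, 0)) = I.D\<phi> I.x0 (y, 0, 0)"
proof -
  obtain v where v: "J (F p) (I.D\<phi> I.x0 (y, 0, 0)) = I.D\<phi> I.x0 (v, 0, 0)" using J_base by blast
  have "I.D\<phi> I.x0 (- v, 0, 0) = - I.D\<phi> I.x0 (v, 0, 0)"
    using linear_neg[OF I.linear_D\<phi>[OF I.domain(2)], of "(v, 0, 0)"] by simp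
  then have "J (F p) (I.D\<phi> I.x0 (- v, 0, 0)) = I.D\<phi> I.x0 (y, 0, 0)"
    using v I.J(2)[of "F p" "I.D\<phi> I.x0 (y, 0, 0)"] linear_neg[OF I.J(1)] by simp
  then show thesis by (rule that)
qed

text \<open>Smoothness of the distributions provides the extension field that
  \<open>second_fundamental_form_eq\<close> asks for.\<close>

lemma sff_eq:
  assumes "x \<in> DR p \<union> DS p"
  shows "second_fundamental_form M N F p v x = I.hessian v x - I.D\<phi> I.x0 (\<Gamma> v x)"
proof -
  have "distribution (atlas M) DR" "distribution (atlas M) DS"
    using J_induced by (auto simp: gen_J_induced_order1_def)
  then obtain W V where "p \<in> W" "smooth_field_on (atlas M) W V" "V p = x"
    using assms unfolding distribution_def by blast
  then show ?thesis using I.second_fundamental_form_eq by blast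
qed

text \<open>Without a normal part \<open>hessian v x\<close> is a multiple of the pushed-forward
  \<open>x\<close>, and skewness makes every vector orthogonal to its image under
  \<open>J\<close>.\<close>

lemma mixed_geodesic_parallel_term:
  assumes "second_fundamental_form M N F p v x = 0" "x \<in> DR p \<union> DS p" "\<Gamma> v x = r *\<^sub>R x"
  shows "metric N (F p) (I.hessian v x) (J (F p) (I.D\<phi> I.x0 x)) = 0"
proof -
  have i: "inner_form (metric N (F p))" using I.riem_N by (simp add: riemannian_manifold_def)
  have "I.hessian v x = r *\<^sub>R I.D\<phi> I.x0 x"
    using sff_eq[OF assms(2), of v] assms by (simp add: linear_cmul[OF I.linear_D\<phi>[OF I.domain(2)]])
  then show ?thesis by (simp add: linear_cmul[OF inner_formD(5)[OF i]] I.metric_J_self)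
qed

lemma mixed_geodesic_warp_derivative:
  assumes "mixed_geodesic M N F DT DR" "mixed_geodesic M N F DT DS"
  shows "f' y = 0" "\<sigma>' y = 0"
proof -
  \<comment> \<open>\<open>hessian_fibre_base\<close> yields the derivatives along the image of
    \<open>v\<close> under \<open>J\<close>, so \<open>v\<close> is chosen to make that image the
    prescribed direction \<open>y\<close>.\<close>
  obtain v where v: "J (F p) (I.D\<phi> I.x0 (v, 0, 0)) = I.D\<phi> I.x0 (y, 0, 0)" by (rule J_base_surj)
  have vT: "(v, 0, 0) \<in> DT p" by (simp add: mem_p)
  \<comment> \<open>Euclidean model spaces have positive dimension, so each fibre has a nonzero
    vector; definiteness of its metric on that vector isolates one warping function.\<close>
  obtain e1 :: 'b where e1: "e1 \<noteq> 0" using nonempty_Basis nonzero_Basis by blast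
  obtain e2 :: 'c where e2: "e2 \<noteq> 0" using nonempty_Basis nonzero_Basis by blast
  have "(0, e1, 0) \<in> DR p" "(0, 0, e2) \<in> DS p" by (simp_all add: mem_p)
  moreover from this have "second_fundamental_form M N F p (v, 0, 0) (0, e1, 0) = 0"
    "second_fundamental_form M N F p (v, 0, 0) (0, 0, e2) = 0"
    using assms vT unfolding mixed_geodesic_def by blast+
  ultimately have "metric N (F p) (I.hessian (v, 0, 0) (0, e1, 0)) (J (F p) (I.D\<phi> I.x0 (0, e1, 0))) = 0"
    "metric N (F p) (I.hessian (v, 0, 0) (0, 0, e2)) (J (F p) (I.D\<phi> I.x0 (0, 0, e2))) = 0"
    using mixed_geodesic_parallel_term \<Gamma>_base_fibre1 \<Gamma>_base_fibre2 by blast+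
  then show "f' y = 0" "\<sigma>' y = 0"
    using warp_pos inner_formD(3)[OF g1_facts(1) e1] inner_formD(3)[OF g2_facts(1) e2]
    unfolding hessian_fibre_base[OF v] by (simp_all add: derivative_zero)
qed

text \<open>With vanishing derivatives the Christoffel term is zero, so \<open>hessian v x\<close>
  is the second fundamental form itself. It is normal by \<open>gauss\<close> and orthogonal to the
  \<open>J\<close>-images of both fibre distributions by \<open>hessian_fibre_base\<close>, which
  places it in the invariant normal subbundle.\<close>

lemma warp_derivative_zero_mixed:
  assumes zero: "\<And>y. f' y = 0" "\<And>y. \<sigma>' y = 0"
    and inv: "invariant_normal_subbundle M N J F DR DS p = {0}"
    and v: "v \<in> DT p" and x: "x \<in> DR p \<union> DS p"
  shows "second_fundamental_form M N F p v x = 0"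
proof -
  obtain v0 where v0: "v = (v0, 0, 0)" using v mem_p(1) by (cases v) auto
  obtain x1 x2 where x12: "x = (0, x1, x2)" using x mem_p(2,3) by (cases x) auto
  have i: "inner_form (metric N (F p))" using I.riem_N by (simp add: riemannian_manifold_def)
  have \<Gamma>0: "\<Gamma> v x = 0"
  proof (rule inner_form_ext[OF G_inner])
    fix w :: "'a \<times> 'b \<times> 'c"
    obtain w0 w1 w2 where w: "w = (w0, w1, w2)" by (cases w) auto
    show "G (\<Gamma> v x) w = G 0 w"
      unfolding v0 x12 w \<Gamma>_base_fibre by (simp add: zero linear_0[OF inner_formD(5)[OF G_inner]])
  qed
  let ?h = "I.hessian v x"
  have normal: "metric N (F p) ?h (push M N F p w) = 0" for w
    using I.gauss[of v x w] by (simp add: \<Gamma>0 I.push_p I.metric_p linear_0[OF inner_formD(5)[OF G_inner]])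
  obtain y where "J (F p) (I.D\<phi> I.x0 (v0, 0, 0)) = I.D\<phi> I.x0 (y, 0, 0)" using J_base by blast
  from hessian_fibre_base[OF this]
  have JW: "metric N (F p) ?h (J (F p) (push M N F p (0, w1, w2))) = 0" for w1 w2
    unfolding v0 x12 I.push_p by (simp add: zero)
  \<comment> \<open>The normal part differs from the full \<open>J\<close>-image by a tangent
    vector, to which \<open>?h\<close> is orthogonal.\<close>
  have "metric N (F p) ?h (normal_part_J M N J F p w) = 0" if "w \<in> DS p" for w
  proof -
    have "orth_proj (metric N (F p)) (range (push M N F p)) (J (F p) (push M N F p w)) \<in> range (push M N F p)"
      unfolding I.push_p
      by (rule orth_proj_range_mem[OF i I.linear_D\<phi>[OF I.domain(2)] I.inj_D\<phi>[OF I.domain(2)]])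
    moreover have "metric N (F p) ?h (J (F p) (push M N F p w)) = 0"
      using JW that mem_p(3) by (cases w) auto
    ultimately show ?thesis unfolding normal_part_J_def
      using normal by (auto simp: linear_diff[OF inner_formD(4)[OF i]])
  qed
  moreover have "metric N (F p) ?h (J (F p) (push M N F p w)) = 0" if "w \<in> DR p" for w
    using JW that mem_p(2) by (cases w) auto
  ultimately have "?h \<in> invariant_normal_subbundle M N J F DR DS p"
    unfolding invariant_normal_subbundle_def normal_space_def using normal by blast
  then have "?h = 0" using inv by blast
  then show ?thesis using sff_eq[OF x, of v] by (simp add: \<Gamma>0 linear_0[OF I.linear_D\<phi>[OF I.domain(2)]])
qed

end

lemma (in biwarped_kaehler_immersion) biwarped_chart_exists:
  "\<exists>c0 c1 c2. biwarped_chart N J MT MR MS f \<sigma> M F DT DR DS \<theta> p c0 c1 c2"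
proof -
  obtain c0 c1 c2 where "c0 \<in> atlas MT" "c1 \<in> atlas MR" "c2 \<in> atlas MS"
    "chart_at (atlas M) p = prod_chart c0 c1 c2"
    using chart_at(1)[OF diff_atlas_M, of p] unfolding atlas_M product_atlas_iff by blast
  then have "biwarped_chart N J MT MR MS f \<sigma> M F DT DR DS \<theta> p c0 c1 c2"
    by unfold_locales
  then show ?thesis by blast
qed

section \<open>Vanishing derivatives and local constancy\<close>

lemma constant_on_derivative_zero:
  assumes A: "diff_atlas A" and c: "c \<in> A" "p \<in> cdom c" and U: "open U" "p \<in> U" "h constant_on U"
  shows "frechet_derivative (\<lambda>x. h (cinv c x)) (at (cmap c p)) = (\<lambda>u. 0)"
proof -
  obtain k where k: "\<And>q. q \<in> U \<Longrightarrow> h q = k" using U(3) unfolding constant_on_def by blast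
  have "((\<lambda>x. h (cinv c x)) has_derivative (\<lambda>u. 0)) (at (cmap c p))"
    by (rule has_derivative_transform_within_open[OF has_derivative_const open_chart_image[OF A c(1) U(1)]])
      (use c U k diff_atlasD(4)[OF A c(1)] in auto)
  then show ?thesis by (rule frechet_derivative_at[symmetric])
qed

text \<open>The chart in which the derivative is known to vanish may change with \<open>q\<close>.
  The transitions carry all this information to one chart around \<open>p\<close>, where a zero
  derivative on a ball, which is convex, gives a constant.\<close>

lemma derivative_zero_locally_constant:
  fixes A :: "('m::topological_space, 'a::euclidean_space) chart set" and h :: "'m \<Rightarrow> real"
  assumes A: "diff_atlas A" and h: "smooth_function A h"
    and zero: "\<And>q. \<exists>c\<in>A. q \<in> cdom c \<and> (\<forall>u. frechet_derivative (\<lambda>x. h (cinv c x)) (at (cmap c q)) u = 0)"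
  shows "\<exists>U. open U \<and> p \<in> U \<and> h constant_on U"
proof -
  define c where "c = chart_at A p"
  have c: "c \<in> A" "p \<in> cdom c" unfolding c_def using chart_at[OF A] by auto
  have D: "((\<lambda>x. h (cinv c x)) has_derivative (\<lambda>u. 0)) (at x)" if "x \<in> cran c" for x
  proof -
    obtain q where q: "q \<in> cdom c" "x = cmap c q" using \<open>x \<in> cran c\<close> by blast
    obtain e where e: "e \<in> A" "q \<in> cdom e"
      "\<And>u. frechet_derivative (\<lambda>x. h (cinv e x)) (at (cmap e q)) u = 0" using zero by blast
    have "(\<lambda>x. h (cinv e x)) differentiable at (cmap e q)"
      using h e smooth_on_differentiable unfolding smooth_function_def by blast
    then have "((\<lambda>x. h (cinv e x)) has_derivative (\<lambda>u. 0)) (at (cmap e q))"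
      using e(3) unfolding frechet_derivative_works by (metis (no_types, lifting) ext)
    moreover have "transition c e x = cmap e q" using q diff_atlasD(4)[OF A c(1)] by (simp add: transition_def)
    ultimately have "((\<lambda>x. h (cinv e (transition c e x))) has_derivative (\<lambda>u. 0)) (at x)"
      using has_derivative_compose[OF transition_has_derivative[OF A c(1) e(1) q(1) e(2)], of "\<lambda>x. h (cinv e x)" "\<lambda>u. 0"]
      by (simp add: q)
    then show ?thesis
      by (rule has_derivative_transform_within_open[OF _ open_chart_image[OF A c(1) diff_atlasD(1)[OF A e(1)]]])
        (use q e diff_atlasD(4)[OF A c(1)] diff_atlasD(4)[OF A e(1)] in \<open>auto simp: transition_def\<close>)
  qed
  have cr: "cmap c p \<in> cran c" using c by blast
  then obtain r where r: "r > 0" "ball (cmap c p) r \<subseteq> cran c"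
    using diff_atlasD(2)[OF A c(1)] openE by blast
  have "\<exists>k. \<forall>x\<in>ball (cmap c p) r. h (cinv c x) = k"
    by (rule has_derivative_zero_constant[OF convex_ball]) (use D r has_derivative_at_withinI in blast)
  then obtain k where k: "\<And>x. x \<in> ball (cmap c p) r \<Longrightarrow> h (cinv c x) = k" by blast
  let ?U = "cdom c \<inter> cmap c -` ball (cmap c p) r"
  have "open ?U" using diff_atlasD[OF A c(1)]
    by (intro continuous_open_preimage) (auto dest: homeomorphism_cont1)
  moreover have "p \<in> ?U" using c r by simp
  moreover have "h q = k" if "q \<in> ?U" for q using k[of "cmap c q"] that diff_atlasD(4)[OF A c(1)] by simp
  then have "h constant_on ?U" unfolding constant_on_def by blast
  ultimately show ?thesis by blast
qed

section \<open>Equivalence of local triviality with the two mixed geodesic conditions\<close>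

theorem theorem5p7:
  fixes Mbar :: "('n::{t2_space, second_countable_topology}, 'e::euclidean_space) riem"
    and J :: "'n \<Rightarrow> 'e \<Rightarrow> 'e"
    and MT :: "('p::{t2_space, second_countable_topology}, 'a::euclidean_space) riem"
    and MR :: "('q::{t2_space, second_countable_topology}, 'b::euclidean_space) riem"
    and MS :: "('r::{t2_space, second_countable_topology}, 'c::euclidean_space) riem"
    and f \<sigma> :: "'p \<Rightarrow> real"
    and M :: "('p \<times> 'q \<times> 'r, 'a \<times> 'b \<times> 'c) riem"
    and \<iota> :: "'p \<times> 'q \<times> 'r \<Rightarrow> 'n"
    and DT DR DS :: "'p \<times> 'q \<times> 'r \<Rightarrow> ('a \<times> 'b \<times> 'c) set"
    and \<theta> :: "'p \<times> 'q \<times> 'r \<Rightarrow> real"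
  assumes "kaehler_manifold Mbar J"
    and "riemannian_manifold MT" and "riemannian_manifold MR" and "riemannian_manifold MS"
    and "smooth_function (atlas MT) f" and "\<forall>x. 0 < f x"
    and "smooth_function (atlas MT) \<sigma>" and "\<forall>x. 0 < \<sigma> x"
    and "M = biwarped_product MT f MR \<sigma> MS"
    and "DT = tangent_factor0 M MR MS"
    and "DR = tangent_factor1 M MT MS"
    and "DS = tangent_factor2 M MT MR"
    and "proper_gen_J_induced_order1 M Mbar J \<iota> DT DR DS \<theta>"
    and "\<forall>p. invariant_normal_subbundle M Mbar J \<iota> DR DS p = {0}"
  shows "locally_trivial f \<sigma> \<longleftrightarrow>
    mixed_geodesic M Mbar \<iota> DT DR \<and> mixed_geodesic M Mbar \<iota> DT DS"
proof -
  interpret biwarped_kaehler_immersion Mbar J MT MR MS f \<sigma> M \<iota> DT DR DS \<theta>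
    by unfold_locales (use assms in \<open>simp_all add: proper_gen_J_induced_order1_def\<close>)
  show ?thesis
  proof (intro iffI conjI)
    assume triv: "locally_trivial f \<sigma>"
    \<comment> \<open>Letting \<open>x\<close> range over the union of \<open>DR\<close> and
      \<open>DS\<close> settles both mixed geodesic conditions at once.\<close>
    have "second_fundamental_form M Mbar \<iota> p v x = 0" if "v \<in> DT p" "x \<in> DR p \<union> DS p" for p v x
    proof -
      obtain c0 c1 c2 where "biwarped_chart Mbar J MT MR MS f \<sigma> M \<iota> DT DR DS \<theta> p c0 c1 c2"
        using biwarped_chart_exists by blast
      then interpret biwarped_chart Mbar J MT MR MS f \<sigma> M \<iota> DT DR DS \<theta> p c0 c1 c2 .
      obtain U where U: "open U" "proj0 p \<in> U" "f constant_on U" "\<sigma> constant_on U"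
        using triv unfolding locally_trivial_def by blast
      show ?thesis
        by (rule warp_derivative_zero_mixed[OF _ _ assms(14)[rule_format] that])
          (simp_all add: constant_on_derivative_zero[OF atlases(1) c0 p_mem(1) U(1,2)] U(3,4))
    qed
    then show "mixed_geodesic M Mbar \<iota> DT DR" "mixed_geodesic M Mbar \<iota> DT DS"
      unfolding mixed_geodesic_def by blast+
  next
    assume mixed: "mixed_geodesic M Mbar \<iota> DT DR \<and> mixed_geodesic M Mbar \<iota> DT DS"
    have zero: "\<exists>c\<in>atlas MT. q \<in> cdom c
        \<and> (\<forall>u. frechet_derivative (\<lambda>x. f (cinv c x)) (at (cmap c q)) u = 0)
        \<and> (\<forall>u. frechet_derivative (\<lambda>x. \<sigma> (cinv c x)) (at (cmap c q)) u = 0)" for q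
    proof -
      \<comment> \<open>The warping functions live on the first factor, so any point of the product
        above \<open>q\<close> serves; \<open>undefined\<close> stands for arbitrary points of the
        fibres.\<close>
      define p :: "'p \<times> 'q \<times> 'r" where "p = (q, undefined, undefined)"
      have p: "proj0 p = q" by (simp add: p_def)
      obtain c0 c1 c2 where "biwarped_chart Mbar J MT MR MS f \<sigma> M \<iota> DT DR DS \<theta> p c0 c1 c2"
        using biwarped_chart_exists by blast
      then interpret biwarped_chart Mbar J MT MR MS f \<sigma> M \<iota> DT DR DS \<theta> p c0 c1 c2 .
      note zero = mixed_geodesic_warp_derivative[OF mixed[THEN conjunct1] mixed[THEN conjunct2], unfolded p]
      show ?thesis using c0 p_mem(1) zero unfolding p by (intro bexI[of _ c0] conjI allI)
    qed
    show "locally_trivial f \<sigma>"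
      unfolding locally_trivial_def
    proof
      fix q
      have "\<exists>U. open U \<and> q \<in> U \<and> f constant_on U"
        by (rule derivative_zero_locally_constant[OF atlases(1) assms(5)]) (use zero in blast)
      moreover have "\<exists>U. open U \<and> q \<in> U \<and> \<sigma> constant_on U"
        by (rule derivative_zero_locally_constant[OF atlases(1) assms(7)]) (use zero in blast)
      ultimately obtain U V
        where "open U" "q \<in> U" "f constant_on U" "open V" "q \<in> V" "\<sigma> constant_on V"
        by blast
      then show "\<exists>U. open U \<and> q \<in> U \<and> f constant_on U \<and> \<sigma> constant_on U"
        by (intro exI[of _ "U \<inter> V"]) (auto intro: constant_on_subset)
    qed
  qed
qed

end
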